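(* Let $k\ge1$ be an integer with prime factorization $k=p_1^{a_1}\cdots p_r^{a_r}$ ($p_1,\dots,p_r$ distinct primes). Suppose that $$L_{D_k}(t)=q_1(t^{p_1})\cdots q_r(t^{p_r})\,L_{D_1}(t)$$ for some polynomials $q_1,\dots,q_r\in\mathbb{Z}[t]$. Then $G_m^{(k)}=G_m^{(1)}$ for every positive integer $m$ with $\gcd(k,m)=1$.
   Context: For $k\ge1$, $D_k$ is the smooth projective (absolutely irreducible) curve over $\mathbb{F}_2$ birational to the affine curve $y^2+y=x^{2^k+1}+x^{-1}$, and $L_{D_k}(t)\in\mathbb{Z}[t]$ is its L-polynomial over $\mathbb{F}_2$, defined by $\exp\left(\sum_{n\ge1}\#D_k(\mathbb{F}_{2^n})\frac{t^n}{n}\right)=\frac{L_{D_k}(t)}{(1-t)(1-2t)}$. For $m\ge1$, $G_m^{(k)}=\sum_{x\in\mathbb{F}_{2^m}^*}(-1)^{\mathrm{Tr}_m(x^{2^k+1}+x^{-1})}$, where $\mathrm{Tr}_m$ is the trace from $\mathbb{F}_{2^m}$ to $\mathbb{F}_2$. *)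

theory Defs
  imports
    "HOL-Library.Z2"
    "HOL-Library.FuncSet"
    "HOL-Computational_Algebra.Computational_Algebra"
    "HOL-Algebra.Algebraic_Closure_Type"
    "HOL-Algebra.Generated_Fields"
begin

section \<open>Finite fields of characteristic 2\<close>

text \<open>
  The type \<^typ>\<open>bit\<close> is the field with two elements.  All finite fields of characteristic 2
  are realised inside one algebraic closure of it: the subfield with \<open>2 ^ n\<close> elements
  (\<open>n \<ge> 1\<close>) is the set of roots of \<open>X ^ (2 ^ n) - X\<close>.
\<close>

definition GF2 :: "nat \<Rightarrow> bit alg_closure set" where
  "GF2 n = {a. a ^ (2 ^ n) = a}"

text \<open>The trace from \<open>GF2 m\<close> to the prime field, the Galois group being generated by squaring.\<close>

definition trace2 :: "nat \<Rightarrow> bit alg_closure \<Rightarrow> bit alg_closure" where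
  "trace2 m a = (\<Sum>i<m. a ^ (2 ^ i))"

text \<open>\<open>(-1) ^ Tr a\<close>; for \<open>a\<close> in \<open>GF2 m\<close> the trace is \<open>0\<close> or \<open>1\<close>.\<close>

definition add_char2 :: "nat \<Rightarrow> bit alg_closure \<Rightarrow> int" where
  "add_char2 m a = (if trace2 m a = 0 then 1 else - 1)"

definition G :: "nat \<Rightarrow> nat \<Rightarrow> int" where
  "G k m = (\<Sum>a\<in>GF2 m - {0}. add_char2 m (a ^ (2 ^ k + 1) + inverse a))"


section \<open>The curves\<close>

text \<open>
  The smooth projective curve birational to \<open>y\<^sup>2 + y = x ^ (2 ^ k + 1) + x ^ (-1)\<close> is taken as
  the abstract nonsingular curve of its function field: its closed points are the valuation
  rings of \<open>F\<^sub>2(x, y)\<close>, the local ring at a closed point being that valuation ring.  The function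
  field is built inside an algebraic closure of the rational function field \<open>F\<^sub>2(x)\<close>.
\<close>

type_synonym alg_fun = "bit poly fract alg_closure"

definition x_coord :: alg_fun where
  "x_coord = to_ac (Fraction_Field.Fract [:0, 1:] 1)"

text \<open>
  The two roots of the defining equation are \<open>y\<close> and \<open>y + 1\<close>, so the function field does not
  depend on which one is chosen.
\<close>

definition y_coord :: "nat \<Rightarrow> alg_fun" where
  "y_coord k = (SOME y. y ^ 2 + y = x_coord ^ (2 ^ k + 1) + inverse x_coord)"

lemma y_coord_equation:
  "y_coord k ^ 2 + y_coord k = x_coord ^ (2 ^ k + 1) + inverse x_coord"
proof -
  let ?c = "x_coord ^ (2 ^ k + 1) + inverse x_coord"
  have "\<exists>y. poly [:- ?c, 1, 1:] y = 0"
    by (rule alg_closed_imp_poly_has_root) auto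
  then obtain y where "poly [:- ?c, 1, 1:] y = 0" by blast
  then have "y ^ 2 + y = ?c"
    by (simp add: algebra_simps power2_eq_square)
  then show ?thesis
    unfolding y_coord_def by (rule someI)
qed

definition function_field :: "nat \<Rightarrow> alg_fun set" where
  "function_field k = generate_field ring_of_type_algebra {x_coord, y_coord k}"

text \<open>
  The places of a one-variable function field \<open>K\<close> over the prime field, which every subring
  contains: the proper subrings \<open>V\<close> of \<open>K\<close> with \<open>z \<in> V\<close> or \<open>1 / z \<in> V\<close> for all nonzero \<open>z\<close> in \<open>K\<close>.
  (For \<open>z = 0\<close> the condition below holds trivially.)  Such rings are automatically discrete
  valuation rings.
\<close>

definition valuation_rings :: "'a::field set \<Rightarrow> 'a set set" where
  "valuation_rings K =
     {V. subring V ring_of_type_algebra \<and> V \<subset> K \<and> (\<forall>z\<in>K. z \<in> V \<or> inverse z \<in> V)}"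

text \<open>
  An \<open>F\<close>-valued point of the curve is a morphism from the spectrum of the field \<open>F\<close> to the curve,
  that is, a closed point, with local ring \<open>V\<close>, together with an embedding of its residue field
  into \<open>F\<close>; equivalently a local homomorphism \<open>V \<rightarrow> F\<close>, one that sends every nonunit of \<open>V\<close>
  to \<open>0\<close>.  Morphisms to a curve over the prime field need no further compatibility.
\<close>

definition curve_points :: "nat \<Rightarrow> nat \<Rightarrow> (alg_fun set \<times> (alg_fun \<Rightarrow> bit alg_closure)) set" where
  "curve_points k n =
     {(V, \<phi>). V \<in> valuation_rings (function_field k) \<and>
        \<phi> \<in> extensional V \<and>
        \<phi> \<in> ring_hom (ring_of_type_algebra\<lparr>carrier := V\<rparr>)
                      (ring_of_type_algebra\<lparr>carrier := GF2 n\<rparr>) \<and>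
        (\<forall>z\<in>V. inverse z \<notin> V \<longrightarrow> \<phi> z = 0)}"


section \<open>The L-polynomial\<close>

definition zeta_log :: "nat \<Rightarrow> rat fps" where
  "zeta_log k = Abs_fps (\<lambda>n. if n = 0 then 0 else of_nat (card (curve_points k n)) / of_nat n)"

definition is_L_polynomial :: "nat \<Rightarrow> int poly \<Rightarrow> bool" where
  "is_L_polynomial k L \<longleftrightarrow>
     fps_exp 1 oo zeta_log k =
       fps_of_poly (map_poly of_int L) / ((1 - fps_X) * (1 - fps_const 2 * fps_X))"

lemma is_L_polynomial_unique:
  assumes "is_L_polynomial k L" and "is_L_polynomial k L'"
  shows "L = L'"
proof -
  let ?d = "(1 - fps_X) * (1 - fps_const 2 * fps_X) :: rat fps"
  have u: "?d $ 0 \<noteq> 0"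
    by simp
  have "fps_of_poly (map_poly of_int M) = (fps_exp 1 oo zeta_log k) * ?d"
    if "is_L_polynomial k M" for M
    using that u unfolding is_L_polynomial_def
    by (simp add: fps_divide_unit inverse_mult_eq_1 mult.assoc del: fps_mult_nth_0)
  then have "fps_of_poly (map_poly of_int L) = (fps_of_poly (map_poly of_int L') :: rat fps)"
    using assms by metis
  then show ?thesis
    by (auto simp: poly_eq_iff fps_eq_iff coeff_map_poly)
qed

end

theory Submission
  imports Defs
begin

text \<open>
  The logarithm of the zeta function turns the hypothesis into a statement about point counts:
  \<open>log q\<^sub>i(t ^ p\<^sub>i)\<close> only involves powers of \<open>t\<close> whose exponents are multiples of \<open>p\<^sub>i\<close>, so
  \<open>D\<^sub>k\<close> and \<open>D\<^sub>1\<close> have the same number of points over the field with \<open>2 ^ m\<close> elements whenever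
  \<open>m\<close> is coprime to \<open>k\<close>.

  The number of points of \<open>D\<^sub>k\<close> is \<open>2 ^ m + 1 + G\<^sub>m\<^sup>(\<^sup>k\<^sup>)\<close>.  Indeed \<open>1 / x\<close> and \<open>x ^ (2 ^ k + 1)\<close> have
  poles of odd order, so there is one point over \<open>x = 0\<close> and one over infinity, and over any
  other \<open>a\<close> the number of solutions of \<open>y\<^sup>2 + y = c\<close> is \<open>1 + (-1) ^ Tr c\<close>.  To match places
  with points, the function field is presented by smooth plane models: at a smooth point
  every rational function is a quotient of two regular ones that do not both vanish there,
  so exactly one place is centred at the point.
\<close>

section \<open>Places and local rings\<close>

text \<open>\<open>curve_points\<close> with the function field and the finite field abstracted, so
  that local arguments can be made for arbitrary fields; \<open>curve_points_eq\<close> specializes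
  back.\<close>

definition places :: "'a::field set \<Rightarrow> 'b::field set \<Rightarrow> ('a set \<times> ('a \<Rightarrow> 'b)) set" where
  "places K F =
     {(V, \<phi>). V \<in> valuation_rings K \<and>
        \<phi> \<in> extensional V \<and>
        \<phi> \<in> ring_hom (ring_of_type_algebra\<lparr>carrier := V\<rparr>)
                      (ring_of_type_algebra\<lparr>carrier := F\<rparr>) \<and>
        (\<forall>z\<in>V. inverse z \<notin> V \<longrightarrow> \<phi> z = 0)}"

definition is_subfield :: "'a::field set \<Rightarrow> bool" where
  "is_subfield K \<longleftrightarrow> 1 \<in> K \<and> (\<forall>x\<in>K. - x \<in> K \<and> inverse x \<in> K \<and> (\<forall>y\<in>K. x + y \<in> K \<and> x * y \<in> K))"

lemma subring_type_algebra_iff: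
  "subring V (ring_of_type_algebra :: 'a::field ring) \<longleftrightarrow>
     1 \<in> V \<and> (\<forall>x\<in>V. - x \<in> V \<and> (\<forall>y\<in>V. x + y \<in> V \<and> x * y \<in> V))"
proof -
  interpret R: field "ring_of_type_algebra :: 'a ring" by (rule field_from_type_algebra)
  have minus: "\<ominus>\<^bsub>ring_of_type_algebra\<^esub> x = - x" for x :: 'a
    by (rule R.minus_equality) (auto simp: ring_of_type_algebra_def)
  show ?thesis
  proof
    assume "subring V (ring_of_type_algebra :: 'a ring)"
    from subringE[OF this] show "1 \<in> V \<and> (\<forall>x\<in>V. - x \<in> V \<and> (\<forall>y\<in>V. x + y \<in> V \<and> x * y \<in> V))"
      unfolding minus by (auto simp: ring_of_type_algebra_def)
  next
    assume "1 \<in> V \<and> (\<forall>x\<in>V. - x \<in> V \<and> (\<forall>y\<in>V. x + y \<in> V \<and> x * y \<in> V))"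
    then show "subring V (ring_of_type_algebra :: 'a ring)"
      by (intro R.subringI) (auto simp: minus, auto simp: ring_of_type_algebra_def)
  qed
qed

lemma places_iff:
  "(V, \<phi>) \<in> places K F \<longleftrightarrow>
     1 \<in> V \<and> (\<forall>x\<in>V. - x \<in> V \<and> (\<forall>y\<in>V. x + y \<in> V \<and> x * y \<in> V)) \<and>
     V \<subset> K \<and> (\<forall>z\<in>K. z \<in> V \<or> inverse z \<in> V) \<and> \<phi> \<in> extensional V \<and>
     \<phi> ` V \<subseteq> F \<and> \<phi> 1 = 1 \<and>
     (\<forall>x\<in>V. \<forall>y\<in>V. \<phi> (x + y) = \<phi> x + \<phi> y \<and> \<phi> (x * y) = \<phi> x * \<phi> y) \<and>
     (\<forall>z\<in>V. inverse z \<notin> V \<longrightarrow> \<phi> z = 0)"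
  unfolding places_def valuation_rings_def
  by (auto simp: subring_type_algebra_iff ring_hom_def Pi_iff; auto simp: ring_of_type_algebra_def)

lemma is_subfield_generate_field:
  "is_subfield (generate_field (ring_of_type_algebra :: 'a::field ring) S)"
proof -
  interpret R: field "ring_of_type_algebra :: 'a ring" by (rule field_from_type_algebra)
  let ?K = "generate_field (ring_of_type_algebra :: 'a::field ring) S"
  have sf: "subfield ?K (ring_of_type_algebra :: 'a ring)"
    by (rule R.generate_field_is_subfield) (simp add: ring_of_type_algebra_def)
  have sr: "1 \<in> ?K \<and> (\<forall>x\<in>?K. - x \<in> ?K \<and> (\<forall>y\<in>?K. x + y \<in> ?K \<and> x * y \<in> ?K))"
    using subfieldE(1)[OF sf] unfolding subring_type_algebra_iff .
  have "inverse x \<in> ?K" if "x \<in> ?K" for x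
  proof (cases "x = 0")
    case True with that show ?thesis by simp
  next
    case False
    have "inv\<^bsub>ring_of_type_algebra\<^esub> x = inverse x"
      by (rule R.comm_inv_char) (use False in \<open>auto simp: ring_of_type_algebra_def\<close>)
    moreover have "inv\<^bsub>ring_of_type_algebra\<^esub> x \<in> ?K"
      using that False by (intro generate_field.m_inv) (auto simp: ring_of_type_algebra_def)
    ultimately show ?thesis by simp
  qed
  with sr show ?thesis unfolding is_subfield_def by blast
qed

lemma generate_field_subset:
  assumes "is_subfield M" "S \<subseteq> M"
  shows "generate_field (ring_of_type_algebra :: 'a::field ring) S \<subseteq> M"
proof -
  interpret R: field "ring_of_type_algebra :: 'a ring" by (rule field_from_type_algebra)
  have inv: "inv\<^bsub>ring_of_type_algebra\<^esub> x = inverse x" if "x \<noteq> 0" for x :: 'a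
    by (rule R.comm_inv_char) (use that in \<open>auto simp: ring_of_type_algebra_def\<close>)
  have minus: "\<ominus>\<^bsub>ring_of_type_algebra\<^esub> x = - x" for x :: 'a
    by (rule R.minus_equality) (auto simp: ring_of_type_algebra_def)
  have "h \<in> M" if "h \<in> generate_field ring_of_type_algebra S" for h
    using that
  proof induction
    case (m_inv h)
    then have "h \<noteq> 0" by (simp add: ring_of_type_algebra_def)
    with m_inv assms show ?case by (simp add: inv is_subfield_def)
  next
    case (a_inv h)
    with assms show ?case by (simp add: minus is_subfield_def)
  qed (use assms in \<open>auto simp: is_subfield_def ring_of_type_algebra_def\<close>)
  then show ?thesis by blast
qed

text \<open>
  \<open>H\<close> is the graph of a homomorphism from a subring of \<open>K\<close> to \<open>F\<close>.  The assumption
  \<open>graph_frac\<close> says that the local ring of its kernel is already a valuation ring.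
\<close>

locale place_graph =
  fixes K :: "'a::field set" and F :: "'b::field set" and H :: "('a \<times> 'b) set"
  assumes subfields: "is_subfield K" "is_subfield F"
    and graph_sub: "H \<subseteq> K \<times> F"
    and graph_one: "(1, 1) \<in> H"
    and graph_uminus: "(A, \<alpha>) \<in> H \<Longrightarrow> (- A, - \<alpha>) \<in> H"
    and graph_add: "(A, \<alpha>) \<in> H \<Longrightarrow> (B, \<beta>) \<in> H \<Longrightarrow> (A + B, \<alpha> + \<beta>) \<in> H"
    and graph_mult: "(A, \<alpha>) \<in> H \<Longrightarrow> (B, \<beta>) \<in> H \<Longrightarrow> (A * B, \<alpha> * \<beta>) \<in> H"
    and graph_zero: "(0, \<alpha>) \<in> H \<Longrightarrow> \<alpha> = 0"
    and graph_frac: "z \<in> K \<Longrightarrow> \<exists>A \<alpha> B \<beta>. (A, \<alpha>) \<in> H \<and> (B, \<beta>) \<in> H \<and> B \<noteq> 0 \<and> z = A / B \<and>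
                       (\<alpha> \<noteq> 0 \<or> \<beta> \<noteq> 0)"
    and graph_nonunit: "\<exists>A. A \<noteq> 0 \<and> (A, 0) \<in> H"
begin

text \<open>The localization at the kernel of the homomorphism with graph \<open>H\<close>, together
  with its map to \<open>F\<close>. Keeping it as a relation turns well-definedness of the map on
  fractions into single-valuedness.\<close>

definition loc :: "('a \<times> 'b) set" where
  "loc = {(A / B, \<alpha> / \<beta>) | A \<alpha> B \<beta>. (A, \<alpha>) \<in> H \<and> (B, \<beta>) \<in> H \<and> \<beta> \<noteq> 0}"

definition ring :: "'a set" where "ring = Domain loc"

definition val :: "'a \<Rightarrow> 'b" where "val = restrict (\<lambda>z. THE \<gamma>. (z, \<gamma>) \<in> loc) ring"

lemma locI: "(A, \<alpha>) \<in> H \<Longrightarrow> (B, \<beta>) \<in> H \<Longrightarrow> \<beta> \<noteq> 0 \<Longrightarrow> (A / B, \<alpha> / \<beta>) \<in> loc"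
  by (auto simp: loc_def)

lemma locE:
  assumes "(z, \<gamma>) \<in> loc"
  obtains A \<alpha> B \<beta> where "(A, \<alpha>) \<in> H" "(B, \<beta>) \<in> H" "\<beta> \<noteq> 0" "B \<noteq> 0" "z = A / B" "\<gamma> = \<alpha> / \<beta>"
  using assms graph_zero unfolding loc_def by blast

lemma loc_graph: "(A, \<alpha>) \<in> H \<Longrightarrow> (A, \<alpha>) \<in> loc"
  using locI[OF _ graph_one] by simp

text \<open>Cross-multiplying two representations puts a pair with first entry 0 into
  \<open>H\<close>, and \<open>graph_zero\<close> makes its second entry 0.\<close>

lemma loc_unique:
  assumes "(z, \<gamma>) \<in> loc" "(z, \<delta>) \<in> loc"
  shows "\<gamma> = \<delta>"
proof -
  obtain A \<alpha> B \<beta> where 1: "(A, \<alpha>) \<in> H" "(B, \<beta>) \<in> H" "\<beta> \<noteq> 0" "B \<noteq> 0" "z = A / B" "\<gamma> = \<alpha> / \<beta>"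
    using assms(1) by (rule locE)
  obtain A' \<alpha>' B' \<beta>' where 2: "(A', \<alpha>') \<in> H" "(B', \<beta>') \<in> H" "\<beta>' \<noteq> 0" "B' \<noteq> 0" "z = A' / B'" "\<delta> = \<alpha>' / \<beta>'"
    using assms(2) by (rule locE)
  have "(A * B' + - (A' * B), \<alpha> * \<beta>' + - (\<alpha>' * \<beta>)) \<in> H"
    by (intro graph_add graph_mult graph_uminus 1 2)
  moreover have "A * B' + - (A' * B) = 0"
    using 1 2 by (simp add: field_simps)
  ultimately have "(0, \<alpha> * \<beta>' + - (\<alpha>' * \<beta>)) \<in> H" by (simp only:)
  from graph_zero[OF this] have "\<alpha> * \<beta>' = \<alpha>' * \<beta>" by simp
  then show ?thesis using 1 2 by (simp add: frac_eq_eq)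
qed

lemma loc_one: "(1, 1) \<in> loc" by (rule loc_graph[OF graph_one])

lemma loc_uminus:
  assumes "(z, \<gamma>) \<in> loc" shows "(- z, - \<gamma>) \<in> loc"
  using assms
proof (rule locE)
  fix A \<alpha> B \<beta>
  assume "(A, \<alpha>) \<in> H" "(B, \<beta>) \<in> H" "\<beta> \<noteq> 0" "z = A / B" "\<gamma> = \<alpha> / \<beta>"
  then show ?thesis using locI[OF graph_uminus, of A \<alpha> B \<beta>] by simp
qed

lemma loc_mult:
  assumes "(z, \<gamma>) \<in> loc" "(z', \<gamma>') \<in> loc" shows "(z * z', \<gamma> * \<gamma>') \<in> loc"
proof -
  obtain A \<alpha> B \<beta> where 1: "(A, \<alpha>) \<in> H" "(B, \<beta>) \<in> H" "\<beta> \<noteq> 0" "B \<noteq> 0" "z = A / B" "\<gamma> = \<alpha> / \<beta>"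
    using assms(1) by (rule locE)
  obtain A' \<alpha>' B' \<beta>' where 2: "(A', \<alpha>') \<in> H" "(B', \<beta>') \<in> H" "\<beta>' \<noteq> 0" "B' \<noteq> 0" "z' = A' / B'" "\<gamma>' = \<alpha>' / \<beta>'"
    using assms(2) by (rule locE)
  have "((A * A') / (B * B'), (\<alpha> * \<alpha>') / (\<beta> * \<beta>')) \<in> loc"
    by (intro locI graph_mult 1 2) (simp add: 1 2)
  then show ?thesis using 1 2 by simp
qed

lemma loc_add:
  assumes "(z, \<gamma>) \<in> loc" "(z', \<gamma>') \<in> loc" shows "(z + z', \<gamma> + \<gamma>') \<in> loc"
proof -
  obtain A \<alpha> B \<beta> where 1: "(A, \<alpha>) \<in> H" "(B, \<beta>) \<in> H" "\<beta> \<noteq> 0" "B \<noteq> 0" "z = A / B" "\<gamma> = \<alpha> / \<beta>"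
    using assms(1) by (rule locE)
  obtain A' \<alpha>' B' \<beta>' where 2: "(A', \<alpha>') \<in> H" "(B', \<beta>') \<in> H" "\<beta>' \<noteq> 0" "B' \<noteq> 0" "z' = A' / B'" "\<gamma>' = \<alpha>' / \<beta>'"
    using assms(2) by (rule locE)
  have "((A * B' + A' * B) / (B * B'), (\<alpha> * \<beta>' + \<alpha>' * \<beta>) / (\<beta> * \<beta>')) \<in> loc"
    by (intro locI graph_mult graph_add 1 2) (simp add: 1 2)
  then show ?thesis using 1 2 by (simp add: add_frac_eq)
qed

lemma loc_sub: "loc \<subseteq> K \<times> F"
proof (rule subrelI)
  fix z \<gamma> assume "(z, \<gamma>) \<in> loc"
  then obtain A \<alpha> B \<beta> where "(A, \<alpha>) \<in> H" "(B, \<beta>) \<in> H" "z = A / B" "\<gamma> = \<alpha> / \<beta>"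
    by (rule locE)
  then have "A \<in> K" "inverse B \<in> K" "\<alpha> \<in> F" "inverse \<beta> \<in> F"
    "z = A * inverse B" "\<gamma> = \<alpha> * inverse \<beta>"
    using graph_sub subfields by (auto simp: is_subfield_def divide_inverse)
  then show "(z, \<gamma>) \<in> K \<times> F" using subfields by (simp add: is_subfield_def)
qed

lemma loc_val: "z \<in> ring \<Longrightarrow> (z, val z) \<in> loc"
  unfolding val_def ring_def using theI'[of "\<lambda>\<gamma>. (z, \<gamma>) \<in> loc"] loc_unique by auto

lemma val_eqI: "(z, \<gamma>) \<in> loc \<Longrightarrow> z \<in> ring \<and> val z = \<gamma>"
  using loc_val loc_unique unfolding ring_def by blast

text \<open>In the fraction from \<open>graph_frac\<close> the values of numerator and denominator
  are not both 0. If the denominator has value 0, the inverted fraction is regular with value 0.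
  This value, beyond mere membership of the inverse, is what \<open>place_unique\<close>
  uses.\<close>

lemma ring_or_inverse:
  assumes "z \<in> K"
  shows "z \<in> ring \<or> (inverse z, 0) \<in> loc"
proof -
  obtain A \<alpha> B \<beta> where AB: "(A, \<alpha>) \<in> H" "(B, \<beta>) \<in> H" "z = A / B" "\<alpha> \<noteq> 0 \<or> \<beta> \<noteq> 0"
    using graph_frac[OF assms] by blast
  show ?thesis
  proof (cases "\<beta> = 0")
    case True
    then have "(B / A, \<beta> / \<alpha>) \<in> loc" using AB by (intro locI) auto
    with True AB show ?thesis by simp
  next
    case False
    then show ?thesis using locI[OF AB(1,2)] AB(3) unfolding ring_def by blast
  qed
qed

lemma place_exists: "(ring, val) \<in> places K F"
proof -
  \<comment> \<open>If a nonzero \<open>A\<close> of value 0 had its inverse in \<open>ring\<close>,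
    then 1 would have value 0. So \<open>ring\<close> is a proper subset of
    \<open>K\<close>.\<close>
  obtain A where A: "A \<noteq> 0" "(A, 0) \<in> H" using graph_nonunit by blast
  have "inverse A \<notin> ring"
  proof
    assume "inverse A \<in> ring"
    then have "(A * inverse A, 0 * val (inverse A)) \<in> loc"
      by (intro loc_mult loc_val loc_graph A)
    with A loc_one loc_unique show False by fastforce
  qed
  moreover have "inverse A \<in> K"
    using A graph_sub subfields(1) by (auto simp: is_subfield_def)
  ultimately have "ring \<noteq> K" by blast
  moreover have "ring \<subseteq> K" using loc_sub by (auto simp: ring_def)
  ultimately have proper: "ring \<subset> K" by blast
  have cl: "- x \<in> ring" if "x \<in> ring" for x
    using val_eqI[OF loc_uminus[OF loc_val[OF that]]] by blast
  have cl2: "x + y \<in> ring \<and> val (x + y) = val x + val y \<and> x * y \<in> ring \<and> val (x * y) = val x * val y"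
    if "x \<in> ring" "y \<in> ring" for x y
    using that val_eqI[OF loc_add[OF loc_val loc_val]] val_eqI[OF loc_mult[OF loc_val loc_val]] by blast
  have nonunit: "val z = 0" if z: "z \<in> ring" "inverse z \<notin> ring" for z
  proof -
    obtain A \<alpha> B \<beta> where AB: "(A, \<alpha>) \<in> H" "(B, \<beta>) \<in> H" "\<beta> \<noteq> 0" "z = A / B" "val z = \<alpha> / \<beta>"
      using loc_val[OF z(1)] by (rule locE)
    have "\<alpha> = 0"
    proof (rule ccontr)
      assume "\<alpha> \<noteq> 0"
      then have "(B / A, \<beta> / \<alpha>) \<in> loc" using AB by (intro locI)
      with AB z(2) show False by (auto simp: ring_def)
    qed
    with AB show ?thesis by simp
  qed
  have "val ` ring \<subseteq> F" using loc_val loc_sub by blast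
  moreover have "z \<in> ring \<or> inverse z \<in> ring" if "z \<in> K" for z
    using ring_or_inverse[OF that] by (auto simp: ring_def)
  moreover have "val \<in> extensional ring" by (simp add: val_def)
  ultimately show ?thesis
    unfolding places_iff using proper cl cl2 nonunit val_eqI[OF loc_one] by simp
qed

lemma val_graph: "(A, \<alpha>) \<in> H \<Longrightarrow> A \<in> ring \<and> val A = \<alpha>"
  by (intro val_eqI loc_graph)

text \<open>Valuation rings are maximal under domination. Elements of nonzero value are units of
  \<open>V\<close>, so \<open>V\<close> contains the local ring with the same values. An element of
  \<open>V\<close> outside \<open>ring\<close> would have an inverse of value 0, which contradicts
  \<open>\<phi> 1 = 1\<close>.\<close>

lemma place_unique:
  assumes pl: "(V, \<phi>) \<in> places K F" and ext: "\<And>A \<alpha>. (A, \<alpha>) \<in> H \<Longrightarrow> A \<in> V \<and> \<phi> A = \<alpha>"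
  shows "V = ring \<and> \<phi> = val"
proof -
  note pl' = pl[unfolded places_iff]
  have unit: "inverse B \<in> V \<and> \<phi> (inverse B) = inverse (\<phi> B)" if "B \<in> V" "\<phi> B \<noteq> 0" for B
  proof -
    have inv: "inverse B \<in> V" using pl' that by blast
    have "B \<noteq> 0"
    proof
      assume "B = 0"
      moreover have "\<phi> (B + B) = \<phi> B + \<phi> B" using pl' that(1) by blast
      ultimately have "\<phi> B + \<phi> B = \<phi> B" by simp
      then show False using that(2) by (metis add_cancel_right_right)
    qed
    then have "\<phi> B * \<phi> (inverse B) = 1"
      using pl' inv that(1) by (metis right_inverse)
    with inv show ?thesis by (simp add: inverse_unique)
  qed
  have in_V: "z \<in> V \<and> \<phi> z = \<gamma>" if z: "(z, \<gamma>) \<in> loc" for z \<gamma>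
  proof -
    obtain A \<alpha> B \<beta> where AB: "(A, \<alpha>) \<in> H" "(B, \<beta>) \<in> H" "\<beta> \<noteq> 0" "z = A / B" "\<gamma> = \<alpha> / \<beta>"
      using z by (rule locE)
    have "inverse B \<in> V \<and> \<phi> (inverse B) = inverse \<beta>" "A \<in> V \<and> \<phi> A = \<alpha>"
      using ext[OF AB(1)] ext[OF AB(2)] unit AB(3) by auto
    then show ?thesis using AB pl' by (simp add: divide_inverse)
  qed
  have "z \<in> ring" if "z \<in> V" for z
  proof (rule ccontr)
    assume "z \<notin> ring"
    then have "(inverse z, 0) \<in> loc" using ring_or_inverse that pl' by blast
    then have iz: "inverse z \<in> V" "\<phi> (inverse z) = 0" using in_V by auto
    have "z \<noteq> 0"
      using \<open>z \<notin> ring\<close> val_eqI[OF loc_add[OF loc_one loc_uminus[OF loc_one]]] by auto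
    then have "\<phi> 1 = \<phi> z * \<phi> (inverse z)" using pl' iz that by (metis right_inverse)
    with iz pl' show False by simp
  qed
  then have V: "V = ring" using in_V loc_val by blast
  moreover have "\<phi> = val"
  proof (rule extensionalityI[of _ V])
    show "\<phi> \<in> extensional V" using pl' by blast
    show "val \<in> extensional V" by (simp add: V val_def)
    show "\<phi> x = val x" if "x \<in> V" for x using in_V loc_val that V by blast
  qed
  ultimately show ?thesis by simp
qed

end

section \<open>Places of quadratic extensions of a rational function field\<close>

text \<open>Serves two purposes: injective instances embed a polynomial ring into the function
  field, instances with nonzero kernel evaluate polynomials at an algebraic point.\<close>

locale poly_ring_hom =
  fixes h :: "'k::field poly \<Rightarrow> 'a::field"
  assumes hom_add [simp]: "h (p + q) = h p + h q"
    and hom_mult [simp]: "h (p * q) = h p * h q"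
    and hom_1 [simp]: "h 1 = 1"
begin

lemma hom_0 [simp]: "h 0 = 0"
  using hom_add[of 0 0] by (simp only: add_cancel_right_right add_0_right)

lemma hom_uminus [simp]: "h (- p) = - h p"
  using hom_add[of p "- p"] by (simp add: eq_neg_iff_add_eq_0 add.commute)

lemma hom_diff [simp]: "h (p - q) = h p - h q"
  using hom_add[of p "- q"] by simp

lemma hom_power [simp]: "h (p ^ n) = h p ^ n"
  by (induction n) simp_all

lemma hom_const_neq_0: "c \<noteq> 0 \<Longrightarrow> h [:c:] \<noteq> 0"
proof
  assume "c \<noteq> 0" "h [:c:] = 0"
  moreover have "h ([:c:] * [:inverse c:]) = h [:c:] * h [:inverse c:]" by (rule hom_mult)
  moreover have "[:c:] * [:inverse c:] = 1" using \<open>c \<noteq> 0\<close> by (simp add: one_pCons)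
  ultimately show False using hom_1 by (metis mult_zero_left zero_neq_one)
qed

lemma hom_pCons: "h (pCons c p) = h [:c:] + h [:0, 1:] * h p"
proof -
  have "pCons c p = [:c:] + [:0, 1:] * p" by simp
  then show ?thesis by (metis hom_add hom_mult)
qed

text \<open>The kernel is a principal ideal, generated by a nonzero element \<open>T\<close> of
  least degree; \<open>T\<close> is the minimal polynomial of the image of X up to a unit.\<close>

lemma kernel_generator:
  assumes "S \<noteq> 0" "h S = 0"
  obtains T where "degree T > 0" "\<And>U. h U = 0 \<Longrightarrow> T dvd U"
proof -
  define Q where "Q p \<longleftrightarrow> p \<noteq> 0 \<and> h p = 0" for p
  define T where "T = (ARG_MIN degree p. Q p)"
  have T: "Q T" and min: "\<And>p. Q p \<Longrightarrow> degree T \<le> degree p"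
    using arg_min_nat_lemma[of Q S degree] assms unfolding T_def Q_def by auto
  have "degree T > 0"
  proof (rule ccontr)
    assume "\<not> degree T > 0"
    then obtain c where "T = [:c:]" by (metis degree_eq_zeroE gr0I)
    with T hom_const_neq_0 show False by (auto simp: Q_def)
  qed
  moreover have "T dvd U" if "h U = 0" for U
  proof -
    have "U = U div T * T + U mod T" by simp
    then have "h (U mod T) = 0" using that T unfolding Q_def
      by (metis hom_add hom_mult mult_zero_right add_0)
    moreover have "\<not> degree T \<le> degree (U mod T)" if "U mod T \<noteq> 0"
      using degree_mod_less[of T U] T that by (simp add: Q_def)
    ultimately have "U mod T = 0" using min Q_def by blast
    then show ?thesis by (simp add: mod_eq_0_iff_dvd)
  qed
  ultimately show thesis by (rule that)
qed

end

text \<open>Infinite descent at X, in the manner of Eisenstein's criterion: X divides P, hence Q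
  since \<open>f1\<close> has nonzero constant term, and cancelling X from both gives the same
  equation with Q of smaller degree.\<close>

lemma quadratic_independent:
  fixes P Q f1 g1 :: "'k::field poly"
  assumes "coeff f1 0 \<noteq> 0" "P ^ 2 = [:0, 1:] * (Q ^ 2 * f1 - g1 * P * Q)"
  shows "P = 0 \<and> Q = 0"
  using assms(2)
proof (induction "degree Q" arbitrary: P Q rule: less_induct)
  case less
  let ?X = "[:0, 1:] :: 'k poly"
  have dvd: "?X dvd p \<longleftrightarrow> poly p 0 = 0" for p
    using poly_eq_0_iff_dvd[of p 0] by simp
  have "?X dvd P ^ 2" unfolding less.prems by (rule dvd_triv_left)
  then have "?X dvd P" by (simp add: dvd)
  then obtain P1 where P1: "P = ?X * P1" ..
  have "?X * (?X * P1 ^ 2) = ?X * (Q ^ 2 * f1 - g1 * P * Q)"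
    using less.prems by (simp only: P1 power2_eq_square ac_simps)
  then have "?X * P1 ^ 2 = Q ^ 2 * f1 - g1 * P * Q"
    unfolding mult_cancel_left by simp
  also have "g1 * P * Q = ?X * (g1 * P1 * Q)"
    by (simp only: P1 ac_simps)
  finally have 1: "?X * P1 ^ 2 = Q ^ 2 * f1 - ?X * (g1 * P1 * Q)" .
  then have "Q ^ 2 * f1 = ?X * (P1 ^ 2 + g1 * P1 * Q)"
    by (simp only: distrib_left diff_add_cancel)
  then have "?X dvd Q ^ 2 * f1" by (metis dvd_triv_left)
  then have "?X dvd Q" using assms(1) by (simp add: dvd flip: poly_0_coeff_0)
  then obtain Q1 where Q1: "Q = ?X * Q1" ..
  have "?X * P1 ^ 2 = ?X * (?X * (Q1 ^ 2 * f1 - g1 * P1 * Q1))"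
    unfolding 1 by (simp only: Q1 power2_eq_square algebra_simps)
  then have 2: "P1 ^ 2 = ?X * (Q1 ^ 2 * f1 - g1 * P1 * Q1)"
    unfolding mult_cancel_left by simp
  show ?case
  proof (cases "Q = 0")
    case True
    then show ?thesis using less.prems by simp
  next
    case False
    then have "Q1 \<noteq> 0" using Q1 by auto
    then have "degree Q1 < degree Q" unfolding Q1 by simp
    from less.hyps[OF this 2] show ?thesis by (simp add: P1 Q1)
  qed
qed

text \<open>
  The curve \<open>w\<^sup>2 = f(s) + g(s) w\<close>, with \<open>E p\<close> standing for \<open>p(s)\<close>.  That \<open>f\<close> and \<open>g\<close> vanish at
  \<open>0\<close>, and \<open>f\<close> only simply, makes the origin a smooth point at which \<open>s\<close> ramifies; this also
  forces \<open>1, w\<close> to be linearly independent over the field of rational functions in \<open>s\<close>.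
\<close>

locale quadratic_model = E: poly_ring_hom E
  for E :: "'k::field poly \<Rightarrow> 'a::field" +
  fixes w :: 'a and f1 g1 :: "'k poly"
  assumes E_inj: "E p = 0 \<Longrightarrow> p = 0"
    and w_eq: "w ^ 2 = E [:0, 1:] * (E f1 + E g1 * w)"
    and f1_0: "coeff f1 0 \<noteq> 0"
begin

definition f where "f = [:0, 1:] * f1"
definition g where "g = [:0, 1:] * g1"

lemma hom_f: "poly_ring_hom h \<Longrightarrow> h f = h [:0, 1:] * h f1"
  and hom_g: "poly_ring_hom h \<Longrightarrow> h g = h [:0, 1:] * h g1"
  by (simp_all only: f_def g_def poly_ring_hom.hom_mult)

lemmas E_f = hom_f[OF E.poly_ring_hom_axioms]
lemmas E_g = hom_g[OF E.poly_ring_hom_axioms]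

definition ev where "ev P Q = E P + E Q * w"

definition fracs where "fracs = {ev P Q / E S | P Q S. S \<noteq> 0}"

lemma w_sq: "w * w = E f + E g * w"
  using w_eq unfolding power2_eq_square E_f E_g by (simp only: algebra_simps)

lemma E_eq_0_iff [simp]: "E p = 0 \<longleftrightarrow> p = 0"
  using E_inj by auto

lemma ev_0 [simp]: "ev P 0 = E P" "ev 0 1 = w"
  by (simp_all add: ev_def)

lemma ev_add: "ev P Q + ev P' Q' = ev (P + P') (Q + Q')"
  by (simp add: ev_def algebra_simps)

lemma ev_uminus: "- ev P Q = ev (- P) (- Q)"
  by (simp add: ev_def algebra_simps)

lemma ev_scale: "E R * ev P Q = ev (R * P) (R * Q)"
  by (simp add: ev_def algebra_simps)

lemma ev_mult: "ev P Q * ev P' Q' = ev (P * P' + f * Q * Q') (P * Q' + Q * P' + g * Q * Q')"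
proof -
  have "ev P Q * ev P' Q' = E P * E P' + (E P * E Q' + E Q * E P') * w + E Q * E Q' * (w * w)"
    by (simp add: ev_def algebra_simps)
  also have "w * w = E f + E g * w" by (rule w_sq)
  finally show ?thesis by (simp add: ev_def algebra_simps)
qed

lemma ev_eq_0: "ev P Q = 0 \<Longrightarrow> P = 0 \<and> Q = 0"
proof -
  assume "ev P Q = 0"
  then have EP: "E P = - (E Q * w)" by (simp add: ev_def eq_neg_iff_add_eq_0)
  then have "E P * E P = E Q * E Q * (w * w)" by simp
  also have "\<dots> = E Q * E Q * E f - E g * E Q * - (E Q * w)"
    unfolding w_sq by (simp add: algebra_simps)
  also have "\<dots> = E (Q * Q * f - g * Q * P)"
    unfolding EP[symmetric] by simp
  finally have "E (P * P - (Q * Q * f - g * Q * P)) = 0" by simp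
  from E_inj[OF this] have "P ^ 2 = Q * Q * f - g * Q * P"
    by (simp only: power2_eq_square right_minus_eq)
  also have "\<dots> = [:0, 1:] * (Q ^ 2 * f1 - g1 * P * Q)"
    unfolding power2_eq_square f_def g_def by (simp only: algebra_simps)
  finally have "P ^ 2 = [:0, 1:] * (Q ^ 2 * f1 - g1 * P * Q)" .
  then show ?thesis using quadratic_independent f1_0 by blast
qed

text \<open>The norm of \<open>P + Q w\<close> down to the rational functions in s. The conjugate of
  w is \<open>g - w\<close>, so the conjugate of \<open>P + Q w\<close> is
  \<open>(P + Q g) - Q w\<close>.\<close>

definition nrm where "nrm P Q = P * P + P * Q * g - Q * Q * f"

lemma ev_conj: "ev P Q * ev (P + Q * g) (- Q) = E (nrm P Q)"
  unfolding ev_mult nrm_def by (simp add: ev_def algebra_simps)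

text \<open>Denominators in s alone suffice because an inverse can be rationalized: multiply by the
  conjugate and divide by the norm.\<close>

lemma fracs_subfield: "is_subfield fracs"
proof -
  have "1 \<in> fracs" unfolding fracs_def using ev_0(1)[of 1] E.hom_1
    by (intro CollectI exI[of _ 1] exI[of _ 0]) simp
  moreover have "- z \<in> fracs \<and> inverse z \<in> fracs" if "z \<in> fracs" for z
  proof -
    obtain P Q S where z: "z = ev P Q / E S" "S \<noteq> 0" using \<open>z \<in> fracs\<close> by (auto simp: fracs_def)
    have "- z = ev (- P) (- Q) / E S" by (simp add: z(1) flip: ev_uminus)
    then have 1: "- z \<in> fracs" using z by (auto simp: fracs_def)
    have "inverse z \<in> fracs"
    proof (cases "ev P Q = 0")
      case True
      then show ?thesis using that z by simp
    next
      case False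
      let ?C = "ev (P + Q * g) (- Q)"
      have C0: "?C \<noteq> 0"
      proof
        assume "?C = 0"
        then have "Q = 0" "P = 0" using ev_eq_0 by force+
        with False show False by simp
      qed
      then have N0: "E (nrm P Q) \<noteq> 0" using False by (simp add: flip: ev_conj)
      have "inverse z = (E S * ?C) / E (nrm P Q)"
        using C0 False z by (simp flip: ev_conj)
      then show ?thesis using N0 unfolding ev_scale fracs_def by auto
    qed
    with 1 show ?thesis by blast
  qed
  moreover have "z + z' \<in> fracs \<and> z * z' \<in> fracs" if "z \<in> fracs" "z' \<in> fracs" for z z'
  proof -
    obtain P Q S where z: "z = ev P Q / E S" "S \<noteq> 0" using \<open>z \<in> fracs\<close> by (auto simp: fracs_def)
    obtain P' Q' S' where z': "z' = ev P' Q' / E S'" "S' \<noteq> 0" using \<open>z' \<in> fracs\<close> by (auto simp: fracs_def)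
    have "z + z' = (E S' * ev P Q + E S * ev P' Q') / E (S * S')"
      using z z' by (simp add: field_simps)
    then have "z + z' \<in> fracs" using z z' unfolding ev_scale ev_add fracs_def
      by (metis (mono_tags, lifting) CollectI no_zero_divisors)
    moreover have "z * z' = (ev P Q * ev P' Q') / E (S * S')"
      using z z' by simp
    then have "z * z' \<in> fracs" using z z' unfolding ev_mult fracs_def
      by (metis (mono_tags, lifting) CollectI no_zero_divisors)
    ultimately show ?thesis ..
  qed
  ultimately show ?thesis unfolding is_subfield_def by blast
qed

lemma E_in_fracs: "E P \<in> fracs" and w_in_fracs: "w \<in> fracs"
proof -
  have *: "ev P Q \<in> fracs" for P Q
    unfolding fracs_def by (intro CollectI exI[of _ P] exI[of _ Q] exI[of _ 1]) simp
  show "E P \<in> fracs" using *[of P 0] by simp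
  show "w \<in> fracs" using *[of 0 1] by simp
qed

end

text \<open>A point \<open>(s, w) = (a, b)\<close> of this curve, with \<open>e p\<close> standing for \<open>p(a)\<close>.\<close>

locale quadratic_point = quadratic_model E w f1 g1 + e: poly_ring_hom e
  for E :: "'k::field poly \<Rightarrow> 'a::field" and w f1 g1
    and e :: "'k poly \<Rightarrow> 'b::field" +
  fixes b :: 'b and K :: "'a set" and F :: "'b set"
  assumes b_eq: "b ^ 2 = e [:0, 1:] * (e f1 + e g1 * b)"
    and smooth: "e [:0, 1:] = 0 \<or> e [:0, 1:] * e g1 \<noteq> 2 * b"
    and algebraic: "\<exists>p. p \<noteq> 0 \<and> e p = 0"
    and K: "is_subfield K" "range E \<subseteq> K" "w \<in> K" "K \<subseteq> fracs"
    and F: "is_subfield F" "range e \<subseteq> F" "b \<in> F"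
begin

definition ev' where "ev' P Q = e P + e Q * b"

text \<open>Evaluation at (a, b) on the coordinate ring of the model. It is single-valued because
  \<open>ev_eq_0\<close> makes the representation by P and Q unique.\<close>

definition graph where "graph = {(ev P Q, ev' P Q) | P Q. True}"

lemmas e_f = hom_f[OF e.poly_ring_hom_axioms]
lemmas e_g = hom_g[OF e.poly_ring_hom_axioms]

lemma b_sq: "b * b = e f + e g * b"
  using b_eq unfolding power2_eq_square e_f e_g by (simp only: algebra_simps)

lemma ev'_0 [simp]: "ev' P 0 = e P" "ev' 0 1 = b"
  by (simp_all add: ev'_def)

lemma ev'_add: "ev' P Q + ev' P' Q' = ev' (P + P') (Q + Q')"
  by (simp add: ev'_def algebra_simps)

lemma ev'_uminus: "- ev' P Q = ev' (- P) (- Q)"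
  by (simp add: ev'_def algebra_simps)

lemma ev'_mult: "ev' P Q * ev' P' Q' = ev' (P * P' + f * Q * Q') (P * Q' + Q * P' + g * Q * Q')"
proof -
  have "ev' P Q * ev' P' Q' = e P * e P' + (e P * e Q' + e Q * e P') * b + e Q * e Q' * (b * b)"
    by (simp add: ev'_def algebra_simps)
  also have "b * b = e f + e g * b" by (rule b_sq)
  finally show ?thesis by (simp add: ev'_def algebra_simps)
qed

lemma graphI: "(ev P Q, ev' P Q) \<in> graph" by (auto simp: graph_def)

lemma graph_mult':
  assumes "(A, \<alpha>) \<in> graph" "(B, \<beta>) \<in> graph" shows "(A * B, \<alpha> * \<beta>) \<in> graph"
proof -
  obtain P Q P' Q' where "A = ev P Q" "\<alpha> = ev' P Q" "B = ev P' Q'" "\<beta> = ev' P' Q'"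
    using assms by (auto simp: graph_def)
  then show ?thesis by (simp only: ev_mult ev'_mult graphI)
qed

lemma graph_E: "(E P, e P) \<in> graph" and graph_w: "(w, b) \<in> graph"
  using graphI[of P 0] graphI[of 0 1] by simp_all

text \<open>While P, Q and S all vanish at a, a common factor from \<open>kernel_generator\<close>
  can be cancelled, which lowers the degree of S. The last clause keeps fractions without w free of
  w, as needed for the norm in \<open>frac_graph\<close>.\<close>

lemma reduced_fraction:
  assumes "S \<noteq> 0"
  shows "\<exists>P' Q' S'. S' \<noteq> 0 \<and> ev P Q / E S = ev P' Q' / E S' \<and> (e P' \<noteq> 0 \<or> e Q' \<noteq> 0 \<or> e S' \<noteq> 0)
           \<and> (Q = 0 \<longrightarrow> Q' = 0)"
  using assms
proof (induction "degree S" arbitrary: P Q S rule: less_induct)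
  case less
  show ?case
  proof (cases "e P \<noteq> 0 \<or> e Q \<noteq> 0 \<or> e S \<noteq> 0")
    case True
    with less.prems show ?thesis by (intro exI[of _ P] exI[of _ Q] exI[of _ S]) simp
  next
    case False
    then obtain T where T: "degree T > 0" "\<And>U. e U = 0 \<Longrightarrow> T dvd U"
      using e.kernel_generator[of S] less.prems by blast
    then obtain P1 Q1 S1 where d: "P = T * P1" "Q = T * Q1" "S = T * S1"
      using False by (meson dvdE)
    have nz: "T \<noteq> 0" "S1 \<noteq> 0" using less.prems d by auto
    then have "degree S1 < degree S" using T(1) by (simp add: d degree_mult_eq)
    moreover have "ev P Q / E S = ev P1 Q1 / E S1"
      unfolding d using nz by (simp flip: ev_scale)
    moreover have "Q = 0 \<longrightarrow> Q1 = 0" using d nz by simp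
    moreover obtain P' Q' S' where "S' \<noteq> 0" "ev P1 Q1 / E S1 = ev P' Q' / E S'"
      "e P' \<noteq> 0 \<or> e Q' \<noteq> 0 \<or> e S' \<noteq> 0" "Q1 = 0 \<longrightarrow> Q' = 0"
      using less.hyps[OF calculation(1) nz(2), of P1 Q1] by blast
    ultimately show ?thesis by (intro exI[of _ P'] exI[of _ Q'] exI[of _ S']) simp
  qed
qed

text \<open>
  This is where smoothness enters.  If numerator and denominator of a reduced fraction both
  vanish at the point, then multiply them by \<open>w\<close> when \<open>a = 0\<close>, using \<open>w\<^sup>2 = s \<cdot> unit\<close>, and by
  the conjugate of the numerator otherwise.
\<close>

lemma frac_graph:
  assumes "z \<in> K"
  shows "\<exists>A \<alpha> B \<beta>. (A, \<alpha>) \<in> graph \<and> (B, \<beta>) \<in> graph \<and> B \<noteq> 0 \<and> z = A / B \<and> (\<alpha> \<noteq> 0 \<or> \<beta> \<noteq> 0)"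
proof -
  let ?X = "[:0, 1:] :: 'k poly"
  obtain P0 Q0 S0 where z0: "z = ev P0 Q0 / E S0" "S0 \<noteq> 0"
    using assms K(4) by (auto simp: fracs_def)
  obtain P Q S where z: "z = ev P Q / E S" "S \<noteq> 0" and nv: "e P \<noteq> 0 \<or> e Q \<noteq> 0 \<or> e S \<noteq> 0"
    using reduced_fraction[OF z0(2), of P0 Q0] z0(1) by metis
  show ?thesis
  proof (cases "e S \<noteq> 0 \<or> ev' P Q \<noteq> 0")
    case True
    then show ?thesis using z graphI[of P Q] graph_E[of S]
      by (intro exI[of _ "ev P Q"] exI[of _ "ev' P Q"] exI[of _ "E S"] exI[of _ "e S"]) auto
  next
    case False
    show ?thesis
    proof (cases "e ?X = 0")
      case True
      then have b: "b = 0" using b_eq by simp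
      have "ev' P Q = e P" by (subst ev'_def) (simp add: b)
      then have e: "e P = 0" "e S = 0" "e Q \<noteq> 0" using False nv by auto
      \<comment> \<open>At a = 0 the kernel of \<open>e\<close> consists of multiples of X, because
        nonzero constants do not vanish.\<close>
      have dvd: "\<exists>q. p = ?X * q" if "e p = 0" for p
      proof -
        obtain c q where p: "p = pCons c q" by (cases p)
        then have "e [:c:] = 0" using that True e.hom_pCons[of c q] by simp
        then have "c = 0" using e.hom_const_neq_0 by blast
        then show ?thesis using p by (intro exI[of _ q]) simp
      qed
      obtain P1 S1 where PS: "P = ?X * P1" "S = ?X * S1" using dvd[OF e(1)] dvd[OF e(2)] by blast
      have "S1 \<noteq> 0" using z PS by auto
      then have nz: "E ?X \<noteq> 0" "w \<noteq> 0" "E S1 \<noteq> 0"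
        using ev_eq_0[of 0 1] by auto
      let ?u = "ev f1 g1"
      have wu: "w * w = E ?X * ?u" using w_eq by (simp add: ev_def power2_eq_square)
      have "ev P Q * w = E ?X * (E P1 * w + E Q * ?u)"
      proof -
        have "ev P Q * w = E ?X * (E P1 * w) + E Q * (w * w)"
          by (simp only: ev_def PS E.hom_mult algebra_simps)
        then show ?thesis unfolding wu by (simp only: algebra_simps)
      qed
      then have "z = (E P1 * w + E Q * ?u) / (E S1 * w)"
        using z nz by (simp only: PS E.hom_mult) (simp add: frac_eq_eq ac_simps)
      \<comment> \<open>After cancelling s from both sides, the new numerator has value
        \<open>e Q * e f1\<close> at the origin, since w vanishes there. Both factors are
        nonzero.\<close>
      moreover have "(E P1 * w + E Q * ?u) = ev (Q * f1) (P1 + Q * g1)"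
        by (simp add: ev_def algebra_simps)
      then have "(E P1 * w + E Q * ?u, ev' (Q * f1) (P1 + Q * g1)) \<in> graph"
        by (simp only: graphI)
      moreover have "ev' (Q * f1) (P1 + Q * g1) = e Q * e f1"
        by (subst ev'_def) (simp add: b)
      moreover have "e f1 \<noteq> 0"
        using dvd[of f1] f1_0 by auto
      moreover have "(E S1 * w, e S1 * b) \<in> graph" by (intro graph_mult' graph_E graph_w)
      ultimately show ?thesis using e nz
        by (intro exI[of _ "E P1 * w + E Q * ?u"] exI[of _ "e Q * e f1"]
              exI[of _ "E S1 * w"] exI[of _ "e S1 * b"]) auto
    next
      case False
      then have g: "e g \<noteq> 2 * b" using smooth e_g by simp
      have S0: "e S = 0" and v0: "ev' P Q = 0" using \<open>\<not> (e S \<noteq> 0 \<or> ev' P Q \<noteq> 0)\<close> by auto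
      have Q: "e Q \<noteq> 0" using S0 v0 nv by (auto simp: ev'_def)
      let ?C = "ev (P + Q * g) (- Q)" and ?C' = "ev' (P + Q * g) (- Q)"
      \<comment> \<open>As the numerator vanishes at the point, its conjugate takes the value
        \<open>e Q * (e g - 2 * b)\<close> there. Up to sign, the second factor is the w-derivative
        of the curve equation, nonzero by smoothness.\<close>
      have "?C' = ev' P Q + e Q * (e g - 2 * b)"
        by (simp add: ev'_def algebra_simps)
      then have C': "?C' \<noteq> 0" using v0 g Q by simp
      have C: "?C \<noteq> 0"
      proof
        assume "?C = 0"
        then have "Q = 0" using ev_eq_0 by force
        with Q show False by simp
      qed
      \<comment> \<open>The norm over S is a rational function in s, so it can be reduced until
        numerator and denominator do not both vanish at a.\<close>
      obtain N S1 where NS: "S1 \<noteq> 0" "ev (nrm P Q) 0 / E S = ev N 0 / E S1" "e N \<noteq> 0 \<or> e S1 \<noteq> 0"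
        using reduced_fraction[OF z(2), of "nrm P Q" 0] by auto
      have "z = E (nrm P Q) / E S / ?C" using C z by (simp flip: ev_conj)
      also have "\<dots> = E N / (E S1 * ?C)" using NS by simp
      finally have "z = E N / (E S1 * ?C)" .
      moreover have "(E S1 * ?C, e S1 * ?C') \<in> graph" by (intro graph_mult' graph_E graphI)
      moreover have "E S1 * ?C \<noteq> 0" using C NS by simp
      moreover have "e N \<noteq> 0 \<or> e S1 * ?C' \<noteq> 0" using NS C' by simp
      ultimately show ?thesis using graph_E by blast
    qed
  qed
qed

sublocale place_graph K F graph
proof
  have "ev P Q \<in> K \<and> ev' P Q \<in> F" for P Q
    using K F unfolding ev_def ev'_def is_subfield_def by (simp add: image_subset_iff)
  then show "graph \<subseteq> K \<times> F" by (auto simp: graph_def)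
  show "(1, 1) \<in> graph" using graph_E[of 1] by simp
  show "(- A, - \<alpha>) \<in> graph" if "(A, \<alpha>) \<in> graph" for A \<alpha>
  proof -
    obtain P Q where "A = ev P Q" "\<alpha> = ev' P Q" using \<open>(A, \<alpha>) \<in> graph\<close> by (auto simp: graph_def)
    then show ?thesis by (simp only: ev_uminus ev'_uminus graphI)
  qed
  show "(A + B, \<alpha> + \<beta>) \<in> graph" if "(A, \<alpha>) \<in> graph" "(B, \<beta>) \<in> graph" for A \<alpha> B \<beta>
  proof -
    obtain P Q P' Q' where "A = ev P Q" "\<alpha> = ev' P Q" "B = ev P' Q'" "\<beta> = ev' P' Q'"
      using \<open>(A, \<alpha>) \<in> graph\<close> \<open>(B, \<beta>) \<in> graph\<close> by (auto simp: graph_def)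
    then show ?thesis by (simp only: ev_add ev'_add graphI)
  qed
  show "\<alpha> = 0" if "(0, \<alpha>) \<in> graph" for \<alpha>
  proof -
    obtain P Q where PQ: "0 = ev P Q" "\<alpha> = ev' P Q" using \<open>(0, \<alpha>) \<in> graph\<close> by (auto simp: graph_def)
    then have "P = 0" "Q = 0" using ev_eq_0[of P Q] by auto
    then show ?thesis by (simp add: PQ(2))
  qed
  show "\<exists>A. A \<noteq> 0 \<and> (A, 0) \<in> graph"
    using algebraic graph_E by (metis E_eq_0_iff)
qed (fact K(1) F(1) graph_mult' frac_graph)+

end

section \<open>Two smooth models of the curve\<close>

lemma add_power_two_power:
  assumes "(2::'a::comm_ring_1) = 0"
  shows "(a + b :: 'a) ^ (2 ^ n) = a ^ (2 ^ n) + b ^ (2 ^ n)"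
proof (induction n)
  case (Suc n)
  have "(a + b) ^ (2 ^ Suc n) = ((a + b) ^ (2 ^ n)) ^ 2" by (simp add: power_mult [symmetric] mult.commute)
  also have "\<dots> = (a ^ (2 ^ n)) ^ 2 + (b ^ (2 ^ n)) ^ 2" by (simp add: Suc power2_sum assms)
  finally show ?case by (simp add: power_mult [symmetric] mult.commute)
qed simp

lemma minus_char2: "(2::'a::comm_ring_1) = 0 \<Longrightarrow> - a = (a::'a)"
  by (metis add.inverse_unique mult_2 mult_zero_left)

lemma two_eq_0 [simp]:
  "(2::bit alg_closure) = 0" "(2::bit poly) = 0" "(2::bit poly fract) = 0" "(2::alg_fun) = 0"
proof -
  show "(2::bit alg_closure) = 0"
    using to_ac_numeral[of "num.Bit0 num.One", where ?'a = bit] by simp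
  show 2: "(2::bit poly) = 0"
    using of_nat_poly[of 2, where ?'a = bit] by simp
  show 3: "(2::bit poly fract) = 0"
    using of_nat_fract[of 2, where ?'a = "bit poly"] 2 by (simp add: Zero_fract_def)
  show "(2::alg_fun) = 0"
    using to_ac_numeral[of "num.Bit0 num.One", where ?'a = "bit poly fract"] 3 by simp
qed

lemma is_subfield_GF2: "is_subfield (GF2 n)"
  unfolding is_subfield_def GF2_def
proof (intro conjI ballI; unfold mem_Collect_eq)
  fix x y :: "bit alg_closure"
  assume x: "x ^ 2 ^ n = x" and y: "y ^ 2 ^ n = y"
  show "(x + y) ^ 2 ^ n = x + y" unfolding add_power_two_power[OF two_eq_0(1)] x y ..
  show "(x * y) ^ 2 ^ n = x * y" unfolding power_mult_distrib x y ..
next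
  fix x :: "bit alg_closure"
  assume x: "x ^ 2 ^ n = x"
  show "(- x) ^ 2 ^ n = - x" unfolding minus_char2[OF two_eq_0(1)] by (rule x)
  show "inverse x ^ 2 ^ n = inverse x" unfolding power_inverse x ..
qed simp

lemma finite_GF2:
  assumes "n \<ge> 1" shows "finite (GF2 n)"
proof -
  let ?p = "monom 1 (2 ^ n) - monom 1 1 :: bit alg_closure poly"
  have "(2::nat) ^ n \<noteq> 1" using assms by simp
  then have "?p \<noteq> 0" by (simp add: monom_eq_iff')
  then have "finite {x. poly ?p x = 0}" by (rule poly_roots_finite)
  then show ?thesis by (simp add: GF2_def poly_monom)
qed

lemma subfield_closed:
  assumes "is_subfield K"
  shows "0 \<in> K" "1 \<in> K" "x \<in> K \<Longrightarrow> - x \<in> K" "x \<in> K \<Longrightarrow> inverse x \<in> K"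
    "x \<in> K \<Longrightarrow> y \<in> K \<Longrightarrow> x + y \<in> K" "x \<in> K \<Longrightarrow> y \<in> K \<Longrightarrow> x * y \<in> K" "x \<in> K \<Longrightarrow> x ^ i \<in> K"
proof -
  have "1 + - 1 \<in> K" using assms unfolding is_subfield_def by blast
  then show "0 \<in> K" by simp
  show "x \<in> K \<Longrightarrow> x ^ i \<in> K" using assms by (induction i) (auto simp: is_subfield_def)
qed (use assms in \<open>auto simp: is_subfield_def\<close>)

lemma poly_ring_hom_eval:
  fixes \<iota> :: "'k::field \<Rightarrow> 'a::field"
  assumes "\<iota> 0 = 0" "\<And>c d. \<iota> (c + d) = \<iota> c + \<iota> d" "\<And>c d. \<iota> (c * d) = \<iota> c * \<iota> d" "\<iota> 1 = 1"
  shows "poly_ring_hom (\<lambda>p. poly (map_poly \<iota> p) a)"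
proof
  have add: "map_poly \<iota> (p + q) = map_poly \<iota> p + map_poly \<iota> q" for p q
    by (rule poly_eqI) (simp add: coeff_map_poly assms)
  show "poly (map_poly \<iota> (p + q)) a = poly (map_poly \<iota> p) a + poly (map_poly \<iota> q) a" for p q
    by (simp add: add)
  show "poly (map_poly \<iota> (p * q)) a = poly (map_poly \<iota> p) a * poly (map_poly \<iota> q) a" for p q
  proof (induction p)
    case (pCons c p)
    have "map_poly \<iota> (pCons c p * q) = smult (\<iota> c) (map_poly \<iota> q) + pCons 0 (map_poly \<iota> (p * q))"
      by (simp add: add map_poly_smult map_poly_pCons assms)
    then show ?case by (simp add: pCons.IH map_poly_pCons assms algebra_simps)
  qed simp
  show "poly (map_poly \<iota> 1) a = 1" by (simp add: map_poly_1 assms)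
qed

text \<open>The coefficients are 0 and 1, so every value is built from the image of X by sums and
  products.\<close>

lemma hom_range_bit:
  fixes h :: "bit poly \<Rightarrow> 'a::field"
  assumes "poly_ring_hom h" "is_subfield K" "h [:0, 1:] \<in> K"
  shows "h p \<in> K"
proof -
  interpret poly_ring_hom h by fact
  show ?thesis
  proof (induction p)
    case 0 then show ?case using subfield_closed(1)[OF assms(2)] by simp
  next
    case (pCons c p)
    have "h [:c:] \<in> K"
      using subfield_closed(1,2)[OF assms(2)] hom_1 by (cases c) (auto simp: one_pCons)
    then show ?case unfolding hom_pCons[of c p]
      by (intro subfield_closed(5,6)[OF assms(2)] pCons.IH assms(3))
  qed
qed

text \<open>Constants are only 0 and 1, which every place must send to 0 and 1. Hence the value of
  the coordinate determines the values of all polynomials in it.\<close>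

lemma places_hom_unique:
  fixes E :: "bit poly \<Rightarrow> 'a::field" and e :: "bit poly \<Rightarrow> 'b::field"
  assumes "poly_ring_hom E" "poly_ring_hom e" "(V, \<phi>) \<in> places K F"
    and "E [:0, 1:] \<in> V" "\<phi> (E [:0, 1:]) = e [:0, 1:]"
  shows "E p \<in> V \<and> \<phi> (E p) = e p"
proof -
  interpret E: poly_ring_hom E by fact
  interpret e: poly_ring_hom e by fact
  note pl = assms(3)[unfolded places_iff]
  have 1: "1 \<in> V" "\<phi> 1 = 1" using pl by blast+
  have "1 + - 1 \<in> V" using pl by blast
  then have 0: "0 \<in> V" by simp
  then have "\<phi> (0 + 0) = \<phi> 0 + \<phi> 0" using pl by blast
  then have 00: "\<phi> 0 = 0" by (simp only: add_0_right add_cancel_right_right)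
  show ?thesis
  proof (induction p)
    case 0 then show ?case by (simp add: \<open>0 \<in> V\<close> 00)
  next
    case (pCons c p)
    have "E [:c:] \<in> V \<and> \<phi> (E [:c:]) = e [:c:]"
      using 0 00 1 E.hom_1 e.hom_1 by (cases c) (auto simp: one_pCons)
    then show ?case unfolding E.hom_pCons[of c p] e.hom_pCons[of c p]
      using pCons.IH assms(4,5) pl by simp
  qed
qed

section \<open>Centres of places on a model\<close>

context quadratic_model
begin

text \<open>Valuation rings are integrally closed: if w were outside V, its inverse would lie in V,
  and dividing the quadratic equation by w would express w through elements of V.\<close>

lemma w_integral:
  assumes "(V, \<phi>) \<in> places K F" "w \<in> K" "range E \<subseteq> V"
  shows "w \<in> V"
proof (rule ccontr)
  assume w: "w \<notin> V"
  note pl = assms(1)[unfolded places_iff]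
  have i: "inverse w \<in> V" using pl w assms(2) by blast
  have E: "E p \<in> V" for p using assms(3) by blast
  have "w \<noteq> 0" using w E[of 0] by auto
  then have "w = w ^ 2 * inverse w" by (simp add: power2_eq_square)
  also have "\<dots> = E [:0, 1:] * (E f1 * inverse w + E g1)"
    unfolding w_eq using \<open>w \<noteq> 0\<close> by (simp add: algebra_simps)
  also have "\<dots> \<in> V"
  proof -
    have "E f1 * inverse w \<in> V" using E[of f1] i pl by simp
    then have "E f1 * inverse w + E g1 \<in> V" using E[of g1] pl by simp
    then show ?thesis using E[of "[:0, 1:]"] pl by simp
  qed
  finally show False using w by simp
qed

lemma place_point_eq:
  assumes "(V, \<phi>) \<in> places K F" "w \<in> V" "\<And>p. E p \<in> V \<and> \<phi> (E p) = e p"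
  shows "\<phi> w ^ 2 = e [:0, 1:] * (e f1 + e g1 * \<phi> w)"
proof -
  note pl = assms(1)[unfolded places_iff]
  have "\<phi> (w * w) = \<phi> w * \<phi> w" using pl assms(2) by blast
  moreover have "\<phi> (E [:0, 1:] * (E f1 + E g1 * w)) = e [:0, 1:] * (e f1 + e g1 * \<phi> w)"
    using pl assms(2,3) by simp
  ultimately show ?thesis using w_eq by (simp add: power2_eq_square)
qed

end

lemma (in quadratic_point) place_unique':
  assumes "(V, \<phi>) \<in> places K F" "\<And>p. E p \<in> V \<and> \<phi> (E p) = e p" "w \<in> V" "\<phi> w = b"
  shows "V = ring \<and> \<phi> = val"
proof (rule place_unique[OF assms(1)])
  note pl = assms(1)[unfolded places_iff]
  fix A \<alpha> assume "(A, \<alpha>) \<in> graph"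
  then obtain P Q where "A = ev P Q" "\<alpha> = ev' P Q" by (auto simp: graph_def)
  then show "A \<in> V \<and> \<phi> A = \<alpha>"
    unfolding ev_def ev'_def using assms(2-4) pl by simp
qed

section \<open>Polynomials in x and in 1 / x inside the function field\<close>

definition base_hom :: "bit poly \<Rightarrow> alg_fun" where
  "base_hom p = to_ac (Fraction_Field.Fract p 1)"

definition inv_hom :: "bit poly \<Rightarrow> alg_fun" where
  "inv_hom p = poly (map_poly (\<lambda>c. base_hom [:c:]) p) (inverse x_coord)"

definition point_hom :: "bit alg_closure \<Rightarrow> bit poly \<Rightarrow> bit alg_closure" where
  "point_hom a p = poly (map_poly to_ac p) a"

lemma base_hom: "poly_ring_hom base_hom"
  by standard (simp_all add: base_hom_def flip: to_ac_add to_ac_mult One_fract_def)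

lemma base_hom_X: "base_hom [:0, 1:] = x_coord"
  by (simp add: base_hom_def x_coord_def)

lemma base_hom_inj: "base_hom p = 0 \<Longrightarrow> p = 0"
  by (simp add: base_hom_def Zero_fract_def eq_fract)

lemma x_coord_neq_0: "x_coord \<noteq> 0"
  using base_hom_inj[of "[:0, 1:]"] by (auto simp: base_hom_X)

lemma point_hom: "poly_ring_hom (point_hom a)"
  unfolding point_hom_def
  by (rule poly_ring_hom_eval) (simp_all only: to_ac_0 to_ac_1 to_ac_add to_ac_mult)

lemma point_hom_X: "point_hom a [:0, 1:] = a"
  by (simp add: point_hom_def map_poly_pCons)

lemma base_hom_const:
  "base_hom [:0:] = 0" "base_hom [:c + d:] = base_hom [:c:] + base_hom [:d:]"
  "base_hom [:c * d:] = base_hom [:c:] * base_hom [:d:]" "base_hom [:1:] = 1"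
proof -
  interpret poly_ring_hom base_hom by (rule base_hom)
  show "base_hom [:0:] = 0" "base_hom [:c + d:] = base_hom [:c:] + base_hom [:d:]"
    "base_hom [:c * d:] = base_hom [:c:] * base_hom [:d:]" "base_hom [:1:] = 1"
    using hom_add[of "[:c:]" "[:d:]"] hom_mult[of "[:c:]" "[:d:]"] hom_1
    by (simp_all add: one_pCons)
qed

lemma inv_hom: "poly_ring_hom inv_hom"
  unfolding inv_hom_def by (rule poly_ring_hom_eval) (simp_all only: base_hom_const)

lemma inv_hom_X: "inv_hom [:0, 1:] = inverse x_coord"
  using base_hom_const by (simp add: inv_hom_def map_poly_pCons)

lemma poly_base_hom: "poly (map_poly (\<lambda>c. base_hom [:c:]) p) x_coord = base_hom p"
proof (induction p)
  case (pCons c p)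
  then show ?case
    using base_hom_const poly_ring_hom.hom_pCons[OF base_hom, of c p]
    by (simp add: map_poly_pCons base_hom_X)
qed (use base_hom_const(1) in simp)

text \<open>Multiplying p(1 / x) by the power of x with exponent \<open>degree p\<close> gives the
  reflected polynomial at x, so injectivity carries over from \<open>base_hom\<close>.\<close>

lemma inv_hom_inj:
  assumes "inv_hom p = 0" shows "p = 0"
proof -
  let ?\<iota> = "\<lambda>c. base_hom [:c:]"
  have nz: "?\<iota> c \<noteq> 0" if "c \<noteq> 0" for c using that base_hom_inj by fastforce
  have "degree (map_poly ?\<iota> p) = degree p" by (rule degree_map_poly) (rule nz)
  then have "map_poly ?\<iota> (reflect_poly p) = reflect_poly (map_poly ?\<iota> p)"
    using base_hom_const(1) by (intro poly_eqI) (simp add: coeff_map_poly coeff_reflect_poly)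
  then have "base_hom (reflect_poly p) = poly (reflect_poly (map_poly ?\<iota> p)) x_coord"
    using poly_base_hom[of "reflect_poly p"] by simp
  also have "\<dots> = 0"
    using assms x_coord_neq_0 by (simp add: poly_reflect_poly_nz inv_hom_def)
  finally have "reflect_poly p = 0" by (rule base_hom_inj)
  then show ?thesis by simp
qed

text \<open>
  With \<open>w = x y\<close> the equation becomes \<open>w\<^sup>2 + x w = x ^ (2 ^ k + 3) + x\<close>, which is smooth also at
  \<open>x = 0\<close>.  At infinity \<open>s = 1 / x\<close> and \<open>w = s ^ (2 ^ (k - 1) + 1) y\<close> satisfy
  \<open>w\<^sup>2 + s ^ (2 ^ (k - 1) + 1) w = s ^ (2 ^ k + 3) + s\<close>.
\<close>

definition affine_w :: "nat \<Rightarrow> alg_fun" where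
  "affine_w k = x_coord * y_coord k"

definition infinite_w :: "nat \<Rightarrow> alg_fun" where
  "infinite_w k = y_coord k * inverse x_coord ^ (2 ^ (k - 1) + 1)"

text \<open>The cofactor \<open>f1\<close> of both models: s times it is s^(2^k + 3) + s. Only
  \<open>g1\<close> differs, being 1 for the affine model and s^(2^(k - 1)) at infinity.\<close>

definition f_poly :: "nat \<Rightarrow> bit poly" where
  "f_poly k = [:0, 1:] ^ (2 ^ k + 2) + 1"

lemma coeff_f_poly: "coeff (f_poly k) 0 \<noteq> 0"
  by (simp add: f_poly_def flip: poly_0_coeff_0)

lemma hom_f_poly: "poly_ring_hom h \<Longrightarrow> h (f_poly k) = h [:0, 1:] ^ (2 ^ k + 2) + 1"
  by (simp only: f_poly_def poly_ring_hom.hom_add poly_ring_hom.hom_power poly_ring_hom.hom_1)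

lemma y_sq: "y_coord k ^ 2 = y_coord k + x_coord ^ (2 ^ k + 1) + inverse x_coord"
proof -
  have "y_coord k ^ 2 = (y_coord k ^ 2 + y_coord k) + - y_coord k" by simp
  then show ?thesis unfolding y_coord_equation minus_char2[OF two_eq_0(4)] by (simp add: ac_simps)
qed

lemma affine_model: "quadratic_model base_hom (affine_w k) (f_poly k) 1"
proof -
  interpret poly_ring_hom base_hom by (rule base_hom)
  show ?thesis
  proof
    have "affine_w k ^ 2 = x_coord ^ 2 * (y_coord k + x_coord ^ (2 ^ k + 1) + inverse x_coord)"
      by (simp add: affine_w_def power_mult_distrib y_sq)
    also have "\<dots> = x_coord * (x_coord ^ (2 ^ k + 2) + 1 + affine_w k)"
      using x_coord_neq_0 by (simp add: affine_w_def power2_eq_square algebra_simps)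
    finally show "affine_w k ^ 2 = base_hom [:0, 1:] * (base_hom (f_poly k) + base_hom 1 * affine_w k)"
      by (simp add: base_hom_X hom_f_poly[OF base_hom])
  qed (use base_hom_inj coeff_f_poly in auto)
qed

lemma infinite_model:
  assumes "k \<ge> 1"
  shows "quadratic_model inv_hom (infinite_w k) (f_poly k) ([:0, 1:] ^ 2 ^ (k - 1))"
proof -
  interpret poly_ring_hom inv_hom by (rule inv_hom)
  let ?s = "inverse x_coord"
  \<comment> \<open>The exponent of s in \<open>infinite_w k ^ 2\<close>. The identity fails for k =
    0, where natural subtraction truncates.\<close>
  have k: "(2 ^ (k - 1) + 1) * 2 = (2::nat) ^ k + 2"
    using assms by (cases k) auto
  show ?thesis
  proof
    have "infinite_w k ^ 2 = (y_coord k + x_coord ^ (2 ^ k + 1) + ?s) * ?s ^ (2 ^ k + 2)"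
      unfolding infinite_w_def power_mult_distrib y_sq power_mult[symmetric] k ..
    also have "\<dots> = y_coord k * ?s ^ (2 ^ k + 2) + x_coord ^ (2 ^ k + 1) * ?s ^ (2 ^ k + 1) * ?s + ?s * ?s ^ (2 ^ k + 2)"
      by (simp add: algebra_simps)
    also have "x_coord ^ (2 ^ k + 1) * ?s ^ (2 ^ k + 1) = 1"
      by (simp only: power_mult_distrib[symmetric] right_inverse[OF x_coord_neq_0] power_one)
    also have "y_coord k * ?s ^ (2 ^ k + 2) = ?s * (?s ^ 2 ^ (k - 1) * infinite_w k)"
      unfolding infinite_w_def k[symmetric] by (simp add: power_add power_mult power2_eq_square power_mult_distrib ac_simps)
    finally show "infinite_w k ^ 2 = inv_hom [:0, 1:] *
        (inv_hom (f_poly k) + inv_hom ([:0, 1:] ^ 2 ^ (k - 1)) * infinite_w k)"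
      by (simp add: inv_hom_X hom_f_poly[OF inv_hom] algebra_simps)
  qed (use inv_hom_inj coeff_f_poly in auto)
qed

section \<open>Smooth points of the two models\<close>

lemma curve_points_eq: "curve_points k n = places (function_field k) (GF2 n)"
  by (simp add: curve_points_def places_def)

lemma function_field_facts:
  "is_subfield (function_field k)" "x_coord \<in> function_field k" "y_coord k \<in> function_field k"
  unfolding function_field_def by (auto intro: is_subfield_generate_field generate_field.incl)

lemma function_field_min: "is_subfield M \<Longrightarrow> x_coord \<in> M \<Longrightarrow> y_coord k \<in> M \<Longrightarrow> function_field k \<subseteq> M"
  unfolding function_field_def by (rule generate_field_subset) auto

text \<open>The second coordinate is x y rather than y, so a = 0 is allowed and contributes the
  single point (0, 0).\<close>

definition affine_points :: "nat \<Rightarrow> nat \<Rightarrow> (bit alg_closure \<times> bit alg_closure) set" where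
  "affine_points k n = {(a, b) \<in> GF2 n \<times> GF2 n. b ^ 2 = a * (a ^ (2 ^ k + 2) + 1 + b)}"

lemma point_hom_algebraic:
  assumes "n \<ge> 1" "a \<in> GF2 n"
  shows "\<exists>p. p \<noteq> 0 \<and> point_hom a p = 0"
proof (intro exI conjI)
  interpret poly_ring_hom "point_hom a" by (rule point_hom)
  let ?p = "[:0, 1:] ^ 2 ^ n - [:0, 1:] :: bit poly"
  show "point_hom a ?p = 0"
    using assms(2) by (simp only: hom_diff hom_power point_hom_X) (simp add: GF2_def)
  show "?p \<noteq> 0"
  proof
    assume "?p = 0"
    then have "degree ([:0, 1:] ^ 2 ^ n :: bit poly) = degree [:0, 1 :: bit:]" by simp
    then have "(2::nat) ^ n = 1" by (simp only: degree_linear_power) simp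
    with assms(1) show False by simp
  qed
qed

lemma affine_quadratic_point:
  assumes "n \<ge> 1" "(a, b) \<in> affine_points k n"
  shows "quadratic_point base_hom (affine_w k) (f_poly k) 1 (point_hom a) b (function_field k) (GF2 n)"
proof -
  interpret quadratic_model base_hom "affine_w k" "f_poly k" 1 by (rule affine_model)
  interpret e: poly_ring_hom "point_hom a" by (rule point_hom)
  have a: "a \<in> GF2 n" and b: "b \<in> GF2 n" using assms(2) by (auto simp: affine_points_def)
  note K = function_field_facts[of k] and cl = subfield_closed[OF function_field_facts(1)[of k]]
  show ?thesis
  proof
    show "b ^ 2 = point_hom a [:0, 1:] * (point_hom a (f_poly k) + point_hom a 1 * b)"
      using assms(2) by (simp add: point_hom_X hom_f_poly[OF point_hom] affine_points_def)
    \<comment> \<open>Since 2 = 0, the condition reads: a is zero or nonzero.\<close>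
    show "point_hom a [:0, 1:] = 0 \<or> point_hom a [:0, 1:] * point_hom a 1 \<noteq> 2 * b"
      by simp
    show "range base_hom \<subseteq> function_field k"
      using hom_range_bit[OF base_hom K(1)] K(2) by (auto simp: base_hom_X)
    show "affine_w k \<in> function_field k" unfolding affine_w_def by (intro cl K)
    show "range (point_hom a) \<subseteq> GF2 n"
      using hom_range_bit[OF point_hom is_subfield_GF2] a by (auto simp: point_hom_X)
    note cl' = subfield_closed[OF fracs_subfield]
    have x: "x_coord \<in> fracs" using E_in_fracs[of "[:0, 1:]"] by (simp add: base_hom_X)
    \<comment> \<open>Recovering y as w / x shows that the model generates the whole function
      field.\<close>
    have "affine_w k * inverse x_coord \<in> fracs" by (intro cl' w_in_fracs x)
    moreover have "affine_w k * inverse x_coord = y_coord k"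
      using x_coord_neq_0 by (simp add: affine_w_def)
    ultimately have "y_coord k \<in> fracs" by simp
    with x show "function_field k \<subseteq> fracs" by (intro function_field_min fracs_subfield)
  qed (use K(1) is_subfield_GF2 b point_hom_algebraic[OF assms(1) a] in auto)
qed

lemma infinite_quadratic_point:
  assumes "n \<ge> 1" "k \<ge> 1"
  shows "quadratic_point inv_hom (infinite_w k) (f_poly k) ([:0, 1:] ^ 2 ^ (k - 1))
           (point_hom 0) 0 (function_field k) (GF2 n)"
proof -
  interpret quadratic_model inv_hom "infinite_w k" "f_poly k" "[:0, 1:] ^ 2 ^ (k - 1)"
    by (rule infinite_model) fact
  interpret e: poly_ring_hom "point_hom 0" by (rule point_hom)
  note F0 = subfield_closed(1)[OF is_subfield_GF2[of n]]
  note K = function_field_facts[of k] and cl = subfield_closed[OF function_field_facts(1)[of k]]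
  show ?thesis
  proof
    show "0 ^ 2 = point_hom 0 [:0, 1:] * (point_hom 0 (f_poly k) + point_hom 0 ([:0, 1:] ^ 2 ^ (k - 1)) * 0)"
      by (simp add: point_hom_X)
    show "point_hom 0 [:0, 1:] = 0 \<or> point_hom 0 [:0, 1:] * point_hom 0 ([:0, 1:] ^ 2 ^ (k - 1)) \<noteq> 2 * 0"
      by (simp add: point_hom_X)
    show "range inv_hom \<subseteq> function_field k"
      using hom_range_bit[OF inv_hom K(1)] cl(4)[OF K(2)] by (auto simp: inv_hom_X)
    show "infinite_w k \<in> function_field k" unfolding infinite_w_def by (intro cl K)
    show "range (point_hom 0) \<subseteq> GF2 n"
      using hom_range_bit[OF point_hom is_subfield_GF2] F0 by (auto simp: point_hom_X)
    note cl' = subfield_closed[OF fracs_subfield]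
    have "inverse x_coord \<in> fracs" using E_in_fracs[of "[:0, 1:]"] by (simp add: inv_hom_X)
    then have x: "x_coord \<in> fracs" using cl'(4) by fastforce
    have "infinite_w k * x_coord ^ (2 ^ (k - 1) + 1) \<in> fracs" by (intro cl' w_in_fracs x)
    moreover have "infinite_w k * x_coord ^ (2 ^ (k - 1) + 1) = y_coord k"
      by (simp only: infinite_w_def mult.assoc power_mult_distrib[symmetric]
          left_inverse[OF x_coord_neq_0] power_one mult_1_right)
    ultimately have "y_coord k \<in> fracs" by simp
    with x show "function_field k \<subseteq> fracs" by (intro function_field_min fracs_subfield)
  qed (use K(1) is_subfield_GF2 F0 point_hom_algebraic[OF assms(1) F0] in auto)
qed

section \<open>Counting points\<close>

text \<open>A place is sent to its centre. Injectivity is uniqueness of the place at a smooth point,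
  surjectivity is its existence.\<close>

lemma bij_betw_affine_places:
  assumes "n \<ge> 1"
  shows "bij_betw (\<lambda>(V, \<phi>). (\<phi> x_coord, \<phi> (affine_w k)))
           {(V, \<phi>) \<in> curve_points k n. x_coord \<in> V} (affine_points k n)"
proof -
  interpret quadratic_model base_hom "affine_w k" "f_poly k" 1 by (rule affine_model)
  let ?A = "{(V, \<phi>) \<in> curve_points k n. x_coord \<in> V}"
  have data: "(\<phi> x_coord, \<phi> (affine_w k)) \<in> affine_points k n \<and> affine_w k \<in> V \<and>
      (\<forall>p. base_hom p \<in> V \<and> \<phi> (base_hom p) = point_hom (\<phi> x_coord) p)"
    if "(V, \<phi>) \<in> ?A" for V \<phi>
  proof -
    have pl: "(V, \<phi>) \<in> places (function_field k) (GF2 n)" and x: "x_coord \<in> V"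
      using that by (auto simp: curve_points_eq)
    have hom: "base_hom p \<in> V \<and> \<phi> (base_hom p) = point_hom (\<phi> x_coord) p" for p
      by (rule places_hom_unique[OF base_hom point_hom pl]) (simp_all add: base_hom_X point_hom_X x)
    have "affine_w k \<in> function_field k"
      unfolding affine_w_def
      by (intro subfield_closed(6)[OF function_field_facts(1)] function_field_facts(2,3))
    then have w: "affine_w k \<in> V" using hom by (intro w_integral[OF pl]) auto
    have "\<phi> x_coord \<in> GF2 n" "\<phi> (affine_w k) \<in> GF2 n"
      using pl x w unfolding places_iff by blast+
    moreover have "\<phi> (affine_w k) ^ 2 = \<phi> x_coord * (\<phi> x_coord ^ (2 ^ k + 2) + 1 + \<phi> (affine_w k))"
      using place_point_eq[OF pl w hom] poly_ring_hom.hom_1[OF point_hom]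
      by (simp add: point_hom_X hom_f_poly[OF point_hom])
    ultimately show ?thesis using hom w by (simp add: affine_points_def)
  qed
  show ?thesis
  proof (rule bij_betwI')
    fix P P' assume P: "P \<in> ?A" and P': "P' \<in> ?A"
    obtain V \<phi> V' \<phi>' where PP: "P = (V, \<phi>)" "P' = (V', \<phi>')" by (cases P, cases P')
    show "(case P of (V, \<phi>) \<Rightarrow> (\<phi> x_coord, \<phi> (affine_w k))) =
        (case P' of (V, \<phi>) \<Rightarrow> (\<phi> x_coord, \<phi> (affine_w k))) \<longleftrightarrow> P = P'"
    proof
      assume "(case P of (V, \<phi>) \<Rightarrow> (\<phi> x_coord, \<phi> (affine_w k))) =
        (case P' of (V, \<phi>) \<Rightarrow> (\<phi> x_coord, \<phi> (affine_w k)))"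
      then have eq: "\<phi>' x_coord = \<phi> x_coord" "\<phi>' (affine_w k) = \<phi> (affine_w k)" by (auto simp: PP)
      note d = data[OF P[unfolded PP]] data[OF P'[unfolded PP]]
      interpret quadratic_point base_hom "affine_w k" "f_poly k" 1 "point_hom (\<phi> x_coord)"
          "\<phi> (affine_w k)" "function_field k" "GF2 n"
        using affine_quadratic_point[OF assms] d(1) by blast
      have "V = ring \<and> \<phi> = val"
        using P d(1) by (intro place_unique') (auto simp: PP curve_points_eq)
      moreover have "V' = ring \<and> \<phi>' = val"
        using P' d(2) eq by (intro place_unique') (auto simp: PP curve_points_eq)
      ultimately show "P = P'" by (simp add: PP)
    qed simp
  next
    fix P assume "P \<in> ?A"
    then show "(case P of (V, \<phi>) \<Rightarrow> (\<phi> x_coord, \<phi> (affine_w k))) \<in> affine_points k n"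
      using data[of "fst P" "snd P"] by (simp add: case_prod_beta)
  next
    fix ab assume "ab \<in> affine_points k n"
    moreover obtain a b where ab: "ab = (a, b)" by (cases ab)
    ultimately interpret quadratic_point base_hom "affine_w k" "f_poly k" 1 "point_hom a"
        b "function_field k" "GF2 n"
      using affine_quadratic_point[OF assms] by blast
    have "x_coord \<in> ring \<and> val x_coord = a" "val (affine_w k) = b"
      using val_graph[OF graph_E[of "[:0, 1:]"]] val_graph[OF graph_w]
      by (simp_all add: base_hom_X point_hom_X)
    then show "\<exists>P\<in>?A. ab = (case P of (V, \<phi>) \<Rightarrow> (\<phi> x_coord, \<phi> (affine_w k)))"
      using place_exists by (intro bexI[of _ "(ring, val)"]) (auto simp: ab curve_points_eq)
  qed
qed

text \<open>If x is not in V, then 1 / x is a nonunit of V and has value 0. The equation of the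
  model at infinity then forces w to have value 0, so the origin is the only possible
  centre.\<close>

lemma card_places_at_infinity:
  assumes "n \<ge> 1" "k \<ge> 1"
  shows "card {(V, \<phi>) \<in> curve_points k n. x_coord \<notin> V} = 1"
proof -
  interpret quadratic_point inv_hom "infinite_w k" "f_poly k" "[:0, 1:] ^ 2 ^ (k - 1)"
      "point_hom 0" 0 "function_field k" "GF2 n"
    using assms by (rule infinite_quadratic_point)
  have "{(V, \<phi>) \<in> curve_points k n. x_coord \<notin> V} = {(ring, val)}"
  proof (intro equalityI subsetI)
    fix P assume "P \<in> {(V, \<phi>) \<in> curve_points k n. x_coord \<notin> V}"
    then obtain V \<phi> where P: "P = (V, \<phi>)" and x: "x_coord \<notin> V"
      and pl: "(V, \<phi>) \<in> places (function_field k) (GF2 n)" by (auto simp: curve_points_eq)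
    note pl' = pl[unfolded places_iff]
    have s: "inverse x_coord \<in> V" using x pl' function_field_facts(2) by blast
    then have "\<phi> (inverse x_coord) = 0" using x pl' by simp
    with s have hom: "inv_hom p \<in> V \<and> \<phi> (inv_hom p) = point_hom 0 p" for p
      by (intro places_hom_unique[OF inv_hom point_hom pl]) (simp_all add: inv_hom_X point_hom_X)
    then have w: "infinite_w k \<in> V" using K(3) by (intro w_integral[OF pl]) auto
    have "\<phi> (infinite_w k) = 0"
      using place_point_eq[OF pl w hom] by (simp add: point_hom_X)
    then show "P \<in> {(ring, val)}" using place_unique'[OF pl hom w] P by simp
  next
    fix P assume "P \<in> {(ring, val)}"
    then have P: "P = (ring, val)" by simp
    have s: "inverse x_coord \<in> ring \<and> val (inverse x_coord) = 0"
      using val_graph[OF graph_E[of "[:0, 1:]"]] by (simp add: inv_hom_X point_hom_X)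
    have "x_coord \<notin> ring"
    proof
      assume "x_coord \<in> ring"
      then have "val (x_coord * inverse x_coord) = val x_coord * val (inverse x_coord)"
        using s place_exists unfolding places_iff by blast
      moreover have "val 1 = 1" using place_exists unfolding places_iff by blast
      ultimately show False using s x_coord_neq_0 by simp
    qed
    with place_exists show "P \<in> {(V, \<phi>) \<in> curve_points k n. x_coord \<notin> V}"
      by (simp add: P curve_points_eq)
  qed
  then show ?thesis by simp
qed

lemma card_curve_points:
  assumes "n \<ge> 1" "k \<ge> 1"
  shows "card (curve_points k n) = card (affine_points k n) + 1"
proof -
  let ?A = "{(V, \<phi>) \<in> curve_points k n. x_coord \<in> V}"
  let ?B = "{(V, \<phi>) \<in> curve_points k n. x_coord \<notin> V}"
  have "finite (affine_points k n)"
    by (rule finite_subset[of _ "GF2 n \<times> GF2 n"])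
      (auto simp: affine_points_def finite_GF2[OF assms(1)])
  then have fA: "finite ?A" using bij_betw_finite[OF bij_betw_affine_places[OF assms(1)]] by blast
  \<comment> \<open>Infinite sets have cardinality 0, so cardinality 1 implies finiteness.\<close>
  have fB: "finite ?B"
    using card_places_at_infinity[OF assms] by (intro card_ge_0_finite) linarith
  have "card (?A \<union> ?B) = card ?A + card ?B" using fA fB by (rule card_Un_disjoint) auto
  also have "?A \<union> ?B = curve_points k n" by auto
  finally show ?thesis
    using bij_betw_same_card[OF bij_betw_affine_places[OF assms(1)]] card_places_at_infinity[OF assms]
    by simp
qed

text \<open>Each squaring replaces y by y + c, and iterating collects the conjugates of c into its
  trace.\<close>

lemma power_two_power_artin_schreier:
  assumes "y ^ 2 + y = (c :: bit alg_closure)"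
  shows "y ^ (2 ^ n) = y + trace2 n c"
proof (induction n)
  case (Suc n)
  have "y ^ (2 ^ Suc n) = (y ^ 2) ^ (2 ^ n)" by (simp flip: power_mult)
  also have "y ^ 2 = c + y"
    using assms minus_char2[OF two_eq_0(1), of y] by (metis add_diff_cancel_right' diff_conv_add_uminus)
  also have "(c + y) ^ (2 ^ n) = c ^ (2 ^ n) + (y + trace2 n c)"
    by (simp add: add_power_two_power Suc)
  finally show ?case by (simp add: trace2_def)
qed (simp add: trace2_def)

text \<open>The two roots y and y + 1 are fixed by the n-th power of Frobenius exactly when the
  trace of c vanishes, which gives 2 or 0 solutions.\<close>

lemma card_artin_schreier:
  "int (card {y \<in> GF2 n. y ^ 2 + y = c}) = 1 + add_char2 n c"
proof -
  have "\<exists>y. poly [:- c, 1, 1:] y = 0" by (rule alg_closed_imp_poly_has_root) auto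
  then obtain y where "poly [:- c, 1, 1:] y = 0" by blast
  then have y: "y ^ 2 + y = c" by (simp add: algebra_simps power2_eq_square)
  have in_iff: "z \<in> GF2 n \<longleftrightarrow> trace2 n c = 0" if "z ^ 2 + z = c" for z
    using power_two_power_artin_schreier[OF that] by (simp add: GF2_def)
  have roots: "z ^ 2 + z = c \<longleftrightarrow> z \<in> {y, y + 1}" for z
  proof -
    have "z ^ 2 + z - c = (z - y) * (z + y + 1)"
      unfolding y[symmetric] by (simp add: algebra_simps power2_eq_square)
    moreover have "z + y + 1 = z - (y + 1)"
      using minus_char2[OF two_eq_0(1), of "y + 1"] by (metis add.assoc diff_conv_add_uminus)
    ultimately have "z ^ 2 + z - c = 0 \<longleftrightarrow> z = y \<or> z = y + 1"
      by (metis mult_eq_0_iff right_minus_eq)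
    then show ?thesis by simp
  qed
  show ?thesis
  proof (cases "trace2 n c = 0")
    case True
    then have "{z \<in> GF2 n. z ^ 2 + z = c} = {y, y + 1}" using in_iff roots by blast
    then show ?thesis using True by (simp add: add_char2_def)
  next
    case False
    then have "{z \<in> GF2 n. z ^ 2 + z = c} = {}" using in_iff by blast
    then show ?thesis using False by (simp only: card.empty add_char2_def) simp
  qed
qed

text \<open>The fibre over 0 is {0}; over a nonzero a the substitution b = a y turns the fibre into
  an Artin-Schreier equation. The cardinality of the multiplicative group can stay unevaluated,
  since it is the same for every k.\<close>

lemma card_affine_points:
  assumes "n \<ge> 1"
  shows "int (card (affine_points k n)) = 1 + int (card (GF2 n - {0})) + G k n"
proof -
  let ?S = "\<lambda>a. {b \<in> GF2 n. b ^ 2 = a * (a ^ (2 ^ k + 2) + 1 + b)}"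
  note fin = finite_GF2[OF assms] and cl = subfield_closed[OF is_subfield_GF2[of n]]
  have "affine_points k n = Sigma (GF2 n) ?S" by (auto simp: affine_points_def)
  then have "card (affine_points k n) = (\<Sum>a\<in>GF2 n. card (?S a))"
    using fin by simp
  also have "\<dots> = card (?S 0) + (\<Sum>a\<in>GF2 n - {0}. card (?S a))"
    using fin cl(1) by (rule sum.remove)
  also have "?S 0 = {0}" using cl(1) by auto
  finally have "int (card (affine_points k n)) = 1 + (\<Sum>a\<in>GF2 n - {0}. int (card (?S a)))"
    by simp
  also have "(\<Sum>a\<in>GF2 n - {0}. int (card (?S a))) =
      (\<Sum>a\<in>GF2 n - {0}. 1 + add_char2 n (a ^ (2 ^ k + 1) + inverse a))"
  proof (rule sum.cong[OF refl])
    fix a assume "a \<in> GF2 n - {0}"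
    then have a: "a \<in> GF2 n" "a \<noteq> 0" by auto
    let ?c = "a ^ (2 ^ k + 1) + inverse a"
    have eq: "y ^ 2 + y = ?c \<longleftrightarrow> (a * y) ^ 2 = a * (a ^ (2 ^ k + 2) + 1 + a * y)" for y
    proof -
      have "a * (a ^ (2 ^ k + 2) + 1 + a * y) = a ^ 2 * (?c + y)"
        using a by (simp add: algebra_simps power2_eq_square)
      then have "(a * y) ^ 2 = a * (a ^ (2 ^ k + 2) + 1 + a * y) \<longleftrightarrow> y ^ 2 = ?c + y"
        using a by (simp add: power_mult_distrib)
      also have "\<dots> \<longleftrightarrow> y ^ 2 + y = ?c"
        using minus_char2[OF two_eq_0(1), of y] by (metis add_diff_cancel_right' diff_add_cancel diff_conv_add_uminus)
      finally show ?thesis by blast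
    qed
    have "bij_betw (\<lambda>y. a * y) {y \<in> GF2 n. y ^ 2 + y = ?c} (?S a)"
    proof (rule bij_betwI[where g = "\<lambda>b. inverse a * b"])
      show "(\<lambda>y. a * y) \<in> {y \<in> GF2 n. y ^ 2 + y = ?c} \<rightarrow> ?S a"
        using eq a cl(6) by auto
      show "(\<lambda>b. inverse a * b) \<in> ?S a \<rightarrow> {y \<in> GF2 n. y ^ 2 + y = ?c}"
      proof
        fix b assume b: "b \<in> ?S a"
        then have "inverse a * b \<in> GF2 n" using a cl(4,6) by auto
        moreover have "a * (inverse a * b) = b" using a(2) by (simp flip: mult.assoc)
        ultimately show "inverse a * b \<in> {y \<in> GF2 n. y ^ 2 + y = ?c}"
          using b eq[of "inverse a * b"] by (simp only: mem_Collect_eq)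
      qed
    qed (use a in auto)
    from bij_betw_same_card[OF this] show "int (card (?S a)) = 1 + add_char2 n ?c"
      using card_artin_schreier[of n ?c] by (simp only:)
  qed
  also have "\<dots> = int (card (GF2 n - {0})) + G k n"
    by (simp add: sum.distrib G_def)
  finally show ?thesis by simp
qed

section \<open>Point counts and the zeta function\<close>

lemma fps_deriv_exp_zeta_log:
  "fps_deriv (fps_exp 1 oo zeta_log k) = (fps_exp 1 oo zeta_log k) * fps_deriv (zeta_log k)"
  by (simp add: fps_compose_deriv zeta_log_def)

text \<open>Differentiation cancels the denominator n and shifts the index by one.\<close>

lemma fps_deriv_zeta_log_nth:
  "n \<ge> 1 \<Longrightarrow> fps_deriv (zeta_log k) $ (n - 1) = of_nat (card (curve_points k n))"
  by (simp add: zeta_log_def)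

text \<open>The power series in t^d, described by their support.\<close>

definition multiples_supported :: "nat \<Rightarrow> 'a::field fps \<Rightarrow> bool" where
  "multiples_supported d u \<longleftrightarrow> (\<forall>n. \<not> d dvd n \<longrightarrow> u $ n = 0)"

lemma multiples_supported_mult: "multiples_supported d u \<Longrightarrow> multiples_supported d v \<Longrightarrow> multiples_supported d (u * v)"
  unfolding multiples_supported_def fps_mult_nth
proof (intro allI impI sum.neutral ballI)
  fix n i assume u: "\<forall>n. \<not> d dvd n \<longrightarrow> u $ n = 0" and v: "\<forall>n. \<not> d dvd n \<longrightarrow> v $ n = 0"
    and n: "\<not> d dvd n" and i: "i \<in> {0..n}"
  have "\<not> (d dvd i \<and> d dvd n - i)" using n i dvd_add[of d i "n - i"] by auto
  then show "u $ i * v $ (n - i) = 0" using u v by auto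
qed

text \<open>Induction along the recursion for the coefficients of the inverse: if d does not divide
  n, it cannot divide both i and n - i.\<close>

lemma multiples_supported_inverse:
  assumes "multiples_supported d u" shows "multiples_supported d (inverse u)"
proof -
  have "inverse u $ n = 0" if "\<not> d dvd n" for n
    using that
  proof (induction n rule: less_induct)
    case (less n)
    then have "n \<noteq> 0" by (metis dvd_0_right)
    then obtain m where n: "n = Suc m" using not0_implies_Suc by blast
    have "u $ i * inverse u $ (n - i) = 0" if "i \<in> {1..n}" for i
    proof (cases "d dvd i")
      case True
      then have "\<not> d dvd n - i" using less.prems that by (metis atLeastAtMost_iff dvd_diffD1 dvd_diffD)
      then show ?thesis using less.IH[of "n - i"] that by auto
    next
      case False
      then show ?thesis using assms by (simp add: multiples_supported_def)
    qed
    then have "(\<Sum>i=1..n. u $ i * inverse u $ (n - i)) = 0" by (intro sum.neutral) blast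
    then show ?case unfolding n by (simp add: fps_inverse_def)
  qed
  then show ?thesis by (simp add: multiples_supported_def)
qed

text \<open>The factor X undoes the index shift of the derivative, which alone would leave the
  multiples of d.\<close>

lemma multiples_supported_X_deriv: "multiples_supported d u \<Longrightarrow> multiples_supported d (fps_X * fps_deriv u)"
  by (auto simp: multiples_supported_def fps_mult_fps_X_deriv_shift)

lemma multiples_supported_pcompose_monom:
  fixes q :: "int poly"
  assumes "d \<ge> 1"
  shows "multiples_supported d (fps_of_poly (map_poly rat_of_int (pcompose q (monom 1 d))))"
proof -
  have "coeff (pcompose q (monom 1 d)) n = 0" if "\<not> d dvd n" for n
    using that
  proof (induction q arbitrary: n)
    case (pCons c q)
    have "coeff (monom 1 d * pcompose q (monom 1 d)) n = 0"
      using pCons by (cases "d \<le> n") (simp_all add: coeff_monom_mult dvd_minus_self)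
    moreover have "n \<noteq> 0" using pCons.prems by (metis dvd_0_right)
    ultimately show ?case by (simp add: pcompose_pCons coeff_pCons split: nat.splits)
  qed simp
  then show ?thesis by (simp add: multiples_supported_def coeff_map_poly)
qed

lemma logarithmic_deriv_prod:
  fixes u :: "nat \<Rightarrow> 'a::field_char_0 fps"
  assumes "\<And>i. i < r \<Longrightarrow> u i $ 0 \<noteq> 0"
  shows "fps_deriv (\<Prod>i<r. u i) * inverse (\<Prod>i<r. u i) = (\<Sum>i<r. fps_deriv (u i) * inverse (u i))"
  using assms
proof (induction r)
  case (Suc r)
  let ?P = "\<Prod>i<r. u i"
  have P0: "?P $ 0 \<noteq> 0" using Suc.prems by (induction r) auto
  have u0: "u r $ 0 \<noteq> 0" using Suc.prems by blast
  have "fps_deriv (\<Prod>i<Suc r. u i) * inverse (\<Prod>i<Suc r. u i)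
      = (fps_deriv ?P * inverse ?P) * (inverse (u r) * u r) + (fps_deriv (u r) * inverse (u r)) * (inverse ?P * ?P)"
    by (simp add: fps_inverse_mult algebra_simps)
  then show ?case using Suc P0 u0 by (simp add: inverse_mult_eq_1)
qed simp

lemma card_curve_points_coprime:
  fixes k r m :: nat and p a :: "nat \<Rightarrow> nat" and q :: "nat \<Rightarrow> int poly"
  assumes "\<And>i. i < r \<Longrightarrow> p i \<ge> 1" and "is_L_polynomial k L" and "is_L_polynomial k' L'"
    and L: "L = (\<Prod>i<r. pcompose (q i) (monom 1 (p i))) * L'"
    and m: "m \<ge> 1" "\<And>i. i < r \<Longrightarrow> \<not> p i dvd m"
  shows "card (curve_points k m) = card (curve_points k' m)"
proof -
  define Z where "Z j = fps_exp 1 oo zeta_log j" for j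
  define ip where "ip M = fps_of_poly (map_poly rat_of_int M)" for M
  let ?d = "(1 - fps_X) * (1 - fps_const 2 * fps_X) :: rat fps"
  define u where "u i = ip (pcompose (q i) (monom 1 (p i)))" for i
  define P where "P = (\<Prod>i<r. u i)"
  have ip_mult: "ip (M * N) = ip M * ip N" for M N
  proof -
    have "map_poly rat_of_int (M * N) = map_poly rat_of_int M * map_poly rat_of_int N"
      by (rule poly_eqI) (simp add: coeff_map_poly coeff_mult)
    then show ?thesis by (simp add: ip_def fps_of_poly_mult)
  qed
  have ip_1: "ip 1 = 1" by (simp add: ip_def)
  have ipL: "ip L = P * ip L'"
  proof -
    have "ip (\<Prod>i<s. pcompose (q i) (monom 1 (p i))) = (\<Prod>i<s. u i)" for s
      by (induction s) (simp_all add: ip_mult ip_1 u_def)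
    then show ?thesis by (simp add: L ip_mult P_def)
  qed
  have div: "A / D * D = A" if "D $ 0 \<noteq> 0" for A D :: "rat fps"
    using that by (simp add: fps_divide_unit inverse_mult_eq_1 mult.assoc)
  have d0: "?d $ 0 \<noteq> 0" by simp
  have Zd: "Z k * ?d = ip L" "Z k' * ?d = ip L'"
    using assms(2,3) unfolding is_L_polynomial_def Z_def ip_def by (simp_all only: div[OF d0])
  then have "Z k * ?d = P * Z k' * ?d" by (simp add: ipL mult.assoc)
  moreover have "?d \<noteq> 0" using d0 by (metis fps_zero_nth)
  ultimately have Z: "Z k = P * Z k'" by simp
  have Z0: "Z j $ 0 = 1" for j by (simp add: Z_def)
  \<comment> \<open>Both zeta functions have constant term 1, so P does as well. This forces every
    factor \<open>u i\<close> to have nonzero constant term, hence to be invertible.\<close>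
  then have P0: "P $ 0 = 1" using arg_cong[OF Z, of "\<lambda>f. f $ 0"] by simp
  have u0: "u i $ 0 \<noteq> 0" if "i < r" for i
  proof -
    have "P $ 0 = (\<Prod>i<r. u i $ 0)" unfolding P_def by (induction r) simp_all
    then show ?thesis using P0 that by (metis finite_lessThan lessThan_iff prod_zero_iff zero_neq_one)
  qed
  have "fps_deriv (Z k) = Z k * fps_deriv (zeta_log k)" "fps_deriv (Z k') = Z k' * fps_deriv (zeta_log k')"
    unfolding Z_def by (rule fps_deriv_exp_zeta_log)+
  moreover have "fps_deriv (Z k) = fps_deriv P * Z k' + P * fps_deriv (Z k')"
    by (simp add: Z)
  ultimately have "Z k' * (P * fps_deriv (zeta_log k)) = Z k' * (fps_deriv P + P * fps_deriv (zeta_log k'))"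
    by (simp add: Z algebra_simps)
  moreover have "Z k' \<noteq> 0" using Z0 by (metis fps_zero_nth zero_neq_one)
  ultimately have "P * fps_deriv (zeta_log k) = fps_deriv P + P * fps_deriv (zeta_log k')" by simp
  from arg_cong[OF this, of "\<lambda>f. inverse P * f"]
  have "inverse P * (P * fps_deriv (zeta_log k)) =
      fps_deriv P * inverse P + inverse P * (P * fps_deriv (zeta_log k'))"
    by (simp only: distrib_left mult.commute[of "inverse P" "fps_deriv P"])
  moreover have "inverse P * (P * A) = A" for A
    using P0 by (simp add: inverse_mult_eq_1 flip: mult.assoc)
  ultimately have "fps_deriv (zeta_log k) = fps_deriv P * inverse P + fps_deriv (zeta_log k')"
    by simp
  also have "fps_deriv P * inverse P = (\<Sum>i<r. fps_deriv (u i) * inverse (u i))"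
    unfolding P_def using u0 by (rule logarithmic_deriv_prod)
  finally have eq: "fps_deriv (zeta_log k) $ (m - 1) =
      (\<Sum>i<r. (fps_deriv (u i) * inverse (u i)) $ (m - 1)) + fps_deriv (zeta_log k') $ (m - 1)"
    by (simp add: fps_sum_nth)
  have "(fps_deriv (u i) * inverse (u i)) $ (m - 1) = 0" if i: "i < r" for i
  proof -
    have "multiples_supported (p i) (u i)" unfolding u_def ip_def using assms(1)[OF i] by (rule multiples_supported_pcompose_monom)
    \<comment> \<open>Multiplying by X moves the coefficient at m - 1 to m, where it vanishes
      because \<open>p i\<close> does not divide m.\<close>
    then have "multiples_supported (p i) (fps_X * fps_deriv (u i) * inverse (u i))"
      by (intro multiples_supported_mult multiples_supported_X_deriv multiples_supported_inverse)
    then have "(fps_X * (fps_deriv (u i) * inverse (u i))) $ m = 0"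
      using m(2)[OF i] by (simp add: multiples_supported_def mult.assoc)
    then show ?thesis using m(1) by simp
  qed
  then have "fps_deriv (zeta_log k) $ (m - 1) = fps_deriv (zeta_log k') $ (m - 1)"
    unfolding eq by simp
  then show ?thesis unfolding fps_deriv_zeta_log_nth[OF m(1)] by simp
qed

theorem theorem19:
  fixes k r :: nat and p a :: "nat \<Rightarrow> nat" and q :: "nat \<Rightarrow> int poly"
    and LDk LD1 :: "int poly"
  assumes "k \<ge> 1"
    and "\<And>i. i < r \<Longrightarrow> prime (p i)"
    and "inj_on p {..<r}"
    and "\<And>i. i < r \<Longrightarrow> a i \<ge> 1"
    and "k = (\<Prod>i<r. p i ^ a i)"
    and "is_L_polynomial k LDk"
    and "is_L_polynomial 1 LD1"
    and "LDk = (\<Prod>i<r. pcompose (q i) (monom 1 (p i))) * LD1"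
  shows "\<forall>m\<ge>1. coprime k m \<longrightarrow> G k m = G 1 m"
proof (intro allI impI)
  fix m :: nat assume m: "m \<ge> 1" "coprime k m"
  have "\<not> p i dvd m" if i: "i < r" for i
  proof
    assume "p i dvd m"
    \<comment> \<open>As the exponent is positive, \<open>p i\<close> divides k and would be a
      common prime factor of k and m.\<close>
    have "p i dvd p i ^ a i" using assms(4)[OF i] by (intro dvd_power) auto
    also have "p i ^ a i dvd k" unfolding assms(5) using i by (intro dvd_prodI) auto
    finally have "p i dvd 1" using m(2) \<open>p i dvd m\<close> coprime_common_divisor by blast
    then show False using assms(2)[OF i] by simp
  qed
  moreover have "p i \<ge> 1" if "i < r" for i
    using prime_gt_0_nat[OF assms(2)[OF that]] by simp
  ultimately have "card (curve_points k m) = card (curve_points 1 m)"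
    using assms(6,7,8) m(1) by (intro card_curve_points_coprime)
  \<comment> \<open>In both counts the contributions other than \<open>G\<close> agree: one point
    over infinity, one over x = 0, and the number of nonzero a.\<close>
  then show "G k m = G 1 m"
    using card_curve_points[OF m(1) assms(1)] card_curve_points[OF m(1), of 1]
      card_affine_points[OF m(1), of k] card_affine_points[OF m(1), of 1] by simp
qed

end
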